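(* Let $(\mathbf{Q}_k)_{k\ge0}$, $(\delta_k)_{k\ge1}$, $(\tilde\delta_k)_{k\ge1}$ be the sequences produced by the following algorithm: $\mathbf{Q}_0=\mathbf{I}_t$ and, for each $k\ge1$, $(\delta_k,\tilde\delta_k)=(\delta(\mathbf{Q}_{k-1}),\tilde\delta(\mathbf{Q}_{k-1}))$ and $\mathbf{Q}_k$ is the maximizer over $\mathcal{C}_1$ of the function $\mathbf{Q}\mapsto V(\delta_k,\tilde\delta_k,\mathbf{Q})$. Assume that $$\lim_{k\to+\infty}(\delta_k-\delta_{k-1})=0,\qquad \lim_{k\to+\infty}(\tilde\delta_k-\tilde\delta_{k-1})=0 .$$ Then the sequence $(\mathbf{Q}_k)_{k\ge0}$ converges toward the (unique) maximizer $\overline{\mathbf{Q}}_*$ of $\bar I$ on $\mathcal{C}_1$.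
   Context: Let $r,t\ge1$ be integers, $\sigma^2>0$, $K\ge0$. Let $\mathbf{A}$ be a deterministic $r\times t$ complex matrix with $\frac1r\mathrm{Tr}(\mathbf{A}\mathbf{A}^H)=1$, and $\mathbf{C}>0$ ($r\times r$), $\tilde{\mathbf{C}}>0$ ($t\times t$) Hermitian positive definite matrices with $\frac1r\mathrm{Tr}\,\mathbf{C}=1$, $\frac1t\mathrm{Tr}\,\tilde{\mathbf{C}}=1$. $\mathcal{C}_1$ is the set of nonnegative Hermitian $t\times t$ matrices $\mathbf{Q}$ with $\frac1t\mathrm{Tr}(\mathbf{Q})=1$. For $\mathbf{Q}\in\mathcal{C}_1$, $(\delta,\tilde\delta)=(\delta(\mathbf{Q}),\tilde\delta(\mathbf{Q}))$ is the unique strictly positive solution of the system $$\delta=\tfrac1t\mathrm{Tr}\left\{\mathbf{C}\left[\sigma^2\left(\mathbf{I}_r+\tfrac{\tilde\delta}{K+1}\mathbf{C}\right)+\tfrac{K}{K+1}\mathbf{A}\mathbf{Q}^{1/2}\left(\mathbf{I}_t+\tfrac{\delta}{K+1}\mathbf{Q}^{1/2}\tilde{\mathbf{C}}\mathbf{Q}^{1/2}\right)^{-1}\mathbf{Q}^{1/2}\mathbf{A}^H\right]^{-1}\right\},$$ $$\tilde\delta=\tfrac1t\mathrm{Tr}\left\{\mathbf{Q}^{1/2}\tilde{\mathbf{C}}\mathbf{Q}^{1/2}\left[\sigma^2\left(\mathbf{I}_t+\tfrac{\delta}{K+1}\mathbf{Q}^{1/2}\tilde{\mathbf{C}}\mathbf{Q}^{1/2}\right)+\tfrac{K}{K+1}\mathbf{Q}^{1/2}\mathbf{A}^H\left(\mathbf{I}_r+\tfrac{\tilde\delta}{K+1}\mathbf{C}\right)^{-1}\mathbf{A}\mathbf{Q}^{1/2}\right]^{-1}\right\}.$$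 For $\kappa,\tilde\kappa\ge0$ and $\mathbf{Q}\in\mathcal{C}_1$, $$V(\kappa,\tilde\kappa,\mathbf{Q})=\log\det\left(\mathbf{I}_t+\tfrac{\kappa}{K+1}\mathbf{Q}^{1/2}\tilde{\mathbf{C}}\mathbf{Q}^{1/2}+\tfrac{K}{\sigma^2(K+1)}\mathbf{Q}^{1/2}\mathbf{A}^H\left(\mathbf{I}_r+\tfrac{\tilde\kappa}{K+1}\mathbf{C}\right)^{-1}\mathbf{A}\mathbf{Q}^{1/2}\right)+\log\det\left(\mathbf{I}_r+\tfrac{\tilde\kappa}{K+1}\mathbf{C}\right)-\tfrac{t\sigma^2\kappa\tilde\kappa}{K+1},$$ and $\bar I(\mathbf{Q})=V(\delta(\mathbf{Q}),\tilde\delta(\mathbf{Q}),\mathbf{Q})$. For fixed $\kappa>0,\tilde\kappa>0$, $\mathbf{Q}\mapsto V(\kappa,\tilde\kappa,\mathbf{Q})$ is strictly concave on $\mathcal{C}_1$, and $\bar I$ is strictly concave on $\mathcal{C}_1$, so the maximizers are unique. *)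

theory Defs
  imports "HOL-Analysis.Analysis"
begin

definition adj :: "complex^'n^'m \<Rightarrow> complex^'m^'n"
  where "adj M = (\<chi> i j. cnj (M $ j $ i))"

definition hermitian :: "complex^'n^'n \<Rightarrow> bool"
  where "hermitian M \<longleftrightarrow> adj M = M"

text \<open>The form \<open>x\<^sup>H M x\<close>; it is real for Hermitian \<open>M\<close>, which is why only its real part
  is used below.\<close>

definition herm_form :: "complex^'n^'n \<Rightarrow> complex^'n \<Rightarrow> complex"
  where "herm_form M x = (\<Sum>i\<in>UNIV. cnj (x $ i) * (M *v x) $ i)"

definition nonneg_hermitian :: "complex^'n^'n \<Rightarrow> bool"
  where "nonneg_hermitian M \<longleftrightarrow> hermitian M \<and> (\<forall>x. 0 \<le> Re (herm_form M x))"

definition pos_def_hermitian :: "complex^'n^'n \<Rightarrow> bool"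
  where "pos_def_hermitian M \<longleftrightarrow> hermitian M \<and> (\<forall>x. x \<noteq> 0 \<longrightarrow> 0 < Re (herm_form M x))"

definition msqrt :: "complex^'n^'n \<Rightarrow> complex^'n^'n"
  where "msqrt M = (THE S. nonneg_hermitian S \<and> S ** S = M)"

definition C1 :: "(complex^'t^'t) set"
  where "C1 = {Q. nonneg_hermitian Q \<and> 1 / of_nat CARD('t) * trace Q = 1}"

text \<open>Throughout, \<open>A\<close> is \<open>r \<times> t\<close> with \<open>r = CARD('r)\<close> and \<open>t = CARD('t)\<close>, and \<open>Ct\<close>, \<open>dt\<close>, \<open>\<kappa>t\<close>
  stand for the tilded quantities paired with \<open>C\<close>, \<open>d\<close>, \<open>\<kappa>\<close>.
  The two traces are complex numbers, so the equations are stated in the complex numbers.\<close>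

definition delta_system ::
  "real \<Rightarrow> real \<Rightarrow> complex^'t^'r \<Rightarrow> complex^'r^'r \<Rightarrow> complex^'t^'t \<Rightarrow> complex^'t^'t
    \<Rightarrow> real \<Rightarrow> real \<Rightarrow> bool"
  where "delta_system \<sigma> K A C Ct Q d dt \<longleftrightarrow>
    complex_of_real d = 1 / of_nat CARD('t) * trace (C **
      matrix_inv (\<sigma>\<^sup>2 *\<^sub>R (mat 1 + (dt / (K + 1)) *\<^sub>R C)
        + (K / (K + 1)) *\<^sub>R (A ** msqrt Q
            ** matrix_inv (mat 1 + (d / (K + 1)) *\<^sub>R (msqrt Q ** Ct ** msqrt Q))
            ** msqrt Q ** adj A))) \<and>
    complex_of_real dt = 1 / of_nat CARD('t) * trace ((msqrt Q ** Ct ** msqrt Q) **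
      matrix_inv (\<sigma>\<^sup>2 *\<^sub>R (mat 1 + (d / (K + 1)) *\<^sub>R (msqrt Q ** Ct ** msqrt Q))
        + (K / (K + 1)) *\<^sub>R (msqrt Q ** adj A
            ** matrix_inv (mat 1 + (dt / (K + 1)) *\<^sub>R C)
            ** A ** msqrt Q)))"

definition deltas ::
  "real \<Rightarrow> real \<Rightarrow> complex^'t^'r \<Rightarrow> complex^'r^'r \<Rightarrow> complex^'t^'t \<Rightarrow> complex^'t^'t
    \<Rightarrow> real \<times> real"
  where "deltas \<sigma> K A C Ct Q =
    (THE p. 0 < fst p \<and> 0 < snd p \<and> delta_system \<sigma> K A C Ct Q (fst p) (snd p))"

text \<open>Both determinants below are real and positive for the matrices of interest, but have complex
  type, hence the \<open>Re\<close> under the real logarithm.\<close>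

definition V ::
  "real \<Rightarrow> real \<Rightarrow> complex^'t^'r \<Rightarrow> complex^'r^'r \<Rightarrow> complex^'t^'t
    \<Rightarrow> real \<Rightarrow> real \<Rightarrow> complex^'t^'t \<Rightarrow> real"
  where "V \<sigma> K A C Ct \<kappa> \<kappa>t Q =
    ln (Re (det (mat 1 + (\<kappa> / (K + 1)) *\<^sub>R (msqrt Q ** Ct ** msqrt Q)
      + (K / (\<sigma>\<^sup>2 * (K + 1))) *\<^sub>R (msqrt Q ** adj A
          ** matrix_inv (mat 1 + (\<kappa>t / (K + 1)) *\<^sub>R C)
          ** A ** msqrt Q))))
    + ln (Re (det (mat 1 + (\<kappa>t / (K + 1)) *\<^sub>R C)))
    - real CARD('t) * \<sigma>\<^sup>2 * \<kappa> * \<kappa>t / (K + 1)"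

definition I_bar ::
  "real \<Rightarrow> real \<Rightarrow> complex^'t^'r \<Rightarrow> complex^'r^'r \<Rightarrow> complex^'t^'t \<Rightarrow> complex^'t^'t \<Rightarrow> real"
  where "I_bar \<sigma> K A C Ct Q =
    V \<sigma> K A C Ct (fst (deltas \<sigma> K A C Ct Q)) (snd (deltas \<sigma> K A C Ct Q)) Q"

end

theory Submission
  imports Defs
begin

text \<open>
  Write \<open>a = 1 / (K + 1)\<close>, \<open>\<tau> = t \<sigma>\<^sup>2\<close>, \<open>F = (K / (\<sigma>\<^sup>2 (K + 1)))\<^sup>1\<^sup>/\<^sup>2 A\<close>, and let \<open>N\<close> be the
  \<open>(t + r) \<times> t\<close> matrix with blocks \<open>I\<close> and \<open>-F\<close>. The proof rests on one formula: by the matrix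
  determinant lemma, for \<open>\<kappa> > 0\<close>,
  \<open>V(\<kappa>, \<kappa>t, Q) = t ln \<kappa> + const + ln det M - a \<tau> \<kappa> \<kappa>t\<close>, where
  \<open>M = diag((a \<kappa> Ct)\<^sup>-\<^sup>1, I + a \<kappa>t C) + N Q N\<^sup>H\<close> is Hermitian positive definite (\<open>V_lifted\<close>).
  Two things can be read off.

  For fixed \<open>\<kappa>\<close> the matrix \<open>M\<close> is affine and injective in \<open>(Q, \<kappa>t)\<close>, so \<open>V(\<kappa>, \<sqdot>, \<sqdot>)\<close> is
  strictly concave jointly in \<open>\<kappa>t\<close> and \<open>Q\<close> (\<open>V_tangent\<close>, from the tangent inequality
  \<open>logdet_tangent\<close>). For fixed \<open>Q\<close> and fixed product \<open>x = \<kappa> \<kappa>t\<close> one has \<open>M = P + \<kappa>\<^sup>-\<^sup>1 R\<close> with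
  \<open>P \<ge> 0\<close> and \<open>R > 0\<close> independent of \<open>\<kappa>\<close>, so \<open>\<kappa> \<mapsto> V(\<kappa>, x / \<kappa>, Q)\<close> is strictly convex in
  \<open>ln \<kappa>\<close> (\<open>logdet_log_convex\<close>). The two equations that define \<open>(\<delta>, \<delta>t)\<close> are equivalent to
  stationarity in \<open>\<kappa>t\<close> for fixed \<open>\<kappa>\<close> and in \<open>\<kappa>\<close> for fixed \<open>\<kappa> \<kappa>t\<close>.
  Hence \<open>(\<delta>(Q), \<delta>t(Q))\<close> is a saddle point:
  \<open>V(\<delta>, \<delta>t, Q)\<close> is the minimum of \<open>V(\<kappa>, \<delta> \<delta>t / \<kappa>, Q)\<close> over \<open>\<kappa>\<close> and the maximum of
  \<open>V(\<delta>, \<kappa>t, Q)\<close> over \<open>\<kappa>t\<close>. Comparing two saddle points gives uniqueness of the solution of the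
  system (\<open>sol_unique\<close>); existence is Brouwer's theorem (\<open>fixed_point_exists\<close>).

  Call \<open>Q\<close> an equilibrium if it maximizes \<open>V(\<delta>(Q), \<delta>t(Q), \<sqdot>)\<close> over the constraint set. At an
  equilibrium with parameters \<open>(\<kappa>, \<kappa>t)\<close>, optimality in \<open>Q\<close> and stationarity in \<open>\<kappa>t\<close> combine,
  by joint concavity, to optimality in \<open>(\<kappa>t, Q)\<close>. So for any other \<open>R\<close>, with parameters
  \<open>(\<kappa>', \<kappa>t')\<close> and \<open>x = \<kappa>' \<kappa>t'\<close>,
  \<open>I_bar R = V(\<kappa>', \<kappa>t', R) \<le> V(\<kappa>, x / \<kappa>, R) < V(\<kappa>, \<kappa>t, Q) = I_bar Q\<close>,
  and an equilibrium is the unique maximizer of \<open>I_bar\<close> (\<open>equilibrium_maximizes_I_bar\<close>).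

  Finally, \<open>\<delta>\<^sub>k - \<delta>\<^sub>k\<^sub>-\<^sub>1 \<longlonglongrightarrow> 0\<close> and \<open>\<delta>t\<^sub>k - \<delta>t\<^sub>k\<^sub>-\<^sub>1 \<longlonglongrightarrow> 0\<close> imply
  that every limit point of the iterates is an equilibrium (\<open>subsequence_equilibrium\<close>). The constraint set is compact, so the sequence converges.
\<close>

section \<open>Matrix algebra\<close>

lemma adj_adj [simp]: "adj (adj M) = M"
  by (simp add: adj_def vec_eq_iff)

lemma adj_mult: "adj (A ** B) = adj B ** adj A"
  by (simp add: adj_def vec_eq_iff matrix_matrix_mult_def mult.commute)

lemma adj_add: "adj (A + B) = adj A + adj B"
  by (simp add: adj_def vec_eq_iff)

lemma adj_diff: "adj (A - B) = adj A - adj B"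
  by (simp add: adj_def vec_eq_iff)

lemma adj_scaleR: "adj (c *\<^sub>R A) = c *\<^sub>R adj A"
  by (simp add: adj_def vec_eq_iff)

lemma adj_one [simp]: "adj (mat 1) = mat 1"
  by (simp add: adj_def vec_eq_iff mat_def)

lemma adj_zero [simp]: "adj 0 = 0"
  by (simp add: adj_def vec_eq_iff)

lemmas adj_simps = adj_mult adj_add adj_diff adj_scaleR

lemma matrix_diff_ldistrib: "A ** (B - C) = A ** B - A ** (C :: complex^'n^'m)"
  by (simp add: vec_eq_iff matrix_matrix_mult_def right_diff_distrib sum_subtractf)

lemma matrix_diff_rdistrib: "(B - C) ** A = B ** A - C ** (A :: complex^'n^'m)"
  by (simp add: vec_eq_iff matrix_matrix_mult_def left_diff_distrib sum_subtractf)

lemma matrix_zero_mult [simp]: "0 ** (A :: complex^'n^'m) = 0" "(B :: complex^'n^'m) ** 0 = 0"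
  by (simp_all add: vec_eq_iff matrix_matrix_mult_def)

lemma scaleR_mult_left: "(c *\<^sub>R A) ** B = c *\<^sub>R (A ** (B :: complex^'n^'m))"
  by (simp add: scalar_matrix_assoc)

lemma scaleR_mult_right: "A ** (c *\<^sub>R B) = c *\<^sub>R (A ** (B :: complex^'n^'m))"
  by (simp add: vec_eq_iff matrix_matrix_mult_def scaleR_sum_right)

lemma matrix_add_rdistrib: "(B + C) ** A = B ** A + C ** (A :: complex^'n^'m)"
  by (simp add: vec_eq_iff matrix_matrix_mult_def distrib_right sum.distrib)

lemma matrix_minus_mult: "(- A) ** B = - (A ** (B :: complex^'n^'m))" "A ** (- B) = - (A ** B)"
  by (simp_all add: vec_eq_iff matrix_matrix_mult_def sum_negf)

lemmas mat_ring = matrix_minus_mult matrix_add_ldistrib matrix_add_rdistrib matrix_diff_ldistrib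
  matrix_diff_rdistrib scaleR_mult_left scaleR_mult_right matrix_mul_assoc

lemma trace_scaleR: "trace (c *\<^sub>R A) = c *\<^sub>R trace (A :: complex^'n^'n)"
  by (simp add: trace_def scaleR_sum_right)

lemma trace_adj: "trace (adj M) = cnj (trace M)"
  by (simp add: trace_def adj_def)

lemma det_adj: "det (adj M) = cnj (det M)"
proof -
  have "det (adj M) = det (transpose (adj M))" by simp
  also have "\<dots> = cnj (det M)"
    by (simp add: det_def transpose_def adj_def)
  finally show ?thesis .
qed

lemma matrix_inv_eq:
  fixes A B :: "complex^'n^'n"
  assumes "A ** B = mat 1"
  shows "matrix_inv A = B"
proof -
  have BA: "B ** A = mat 1" using assms matrix_left_right_inverse by blast
  have "A ** matrix_inv A = mat 1 \<and> matrix_inv A ** A = mat 1"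
    unfolding matrix_inv_def by (rule someI[of _ B]) (use assms BA in simp)
  then have "B ** (A ** matrix_inv A) = B" by simp
  then show ?thesis by (simp add: matrix_mul_assoc BA)
qed

lemma matrix_inv_mult:
  assumes "invertible (A :: complex^'n^'n)"
  shows "A ** matrix_inv A = mat 1" "matrix_inv A ** A = mat 1"
proof -
  obtain B where B: "A ** B = mat 1" "B ** A = mat 1"
    using assms unfolding invertible_def by blast
  have "matrix_inv A = B" using matrix_inv_eq[OF B(1)] .
  with B show "A ** matrix_inv A = mat 1" "matrix_inv A ** A = mat 1" by simp_all
qed

lemma invertible_adj: "invertible M \<Longrightarrow> invertible (adj M)"
  by (metis invertible_def adj_mult adj_one)

lemma adj_matrix_inv:
  assumes "invertible (A :: complex^'n^'n)"
  shows "adj (matrix_inv A) = matrix_inv (adj A)"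
  by (rule matrix_inv_eq[symmetric]) (metis adj_mult adj_one assms matrix_inv_mult(2))

lemma matrix_inv_scaleR:
  assumes "invertible (A :: complex^'n^'n)" "c \<noteq> 0"
  shows "matrix_inv (c *\<^sub>R A) = (1 / c) *\<^sub>R matrix_inv A"
  by (rule matrix_inv_eq) (simp add: assms scaleR_mult_left scaleR_mult_right matrix_inv_mult)

section \<open>Positive Hermitian matrices\<close>

text \<open>The complex inner product, conjugate-linear in the first argument. Its real part is the
  Euclidean inner product of the underlying real space, which gives access to norms and
  orthogonality.\<close>

definition cip :: "complex^'n \<Rightarrow> complex^'n \<Rightarrow> complex"
  where "cip x y = (\<Sum>i\<in>UNIV. cnj (x $ i) * y $ i)"

lemma herm_form_cip: "herm_form M x = cip x (M *v x)"
  by (simp add: herm_form_def cip_def)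

lemma Re_cip: "Re (cip x y) = inner x y"
  by (simp add: cip_def inner_vec_def inner_complex_def)

lemma cip_adj: "cip x (M *v y) = cip (adj M *v x) y"
proof -
  have "cip x (M *v y) = (\<Sum>i\<in>UNIV. \<Sum>j\<in>UNIV. cnj (x $ i) * M $ i $ j * y $ j)"
    by (simp add: cip_def matrix_vector_mult_def sum_distrib_left mult.assoc)
  also have "\<dots> = (\<Sum>j\<in>UNIV. \<Sum>i\<in>UNIV. cnj (x $ i) * M $ i $ j * y $ j)"
    by (rule sum.swap)
  also have "\<dots> = cip (adj M *v x) y"
    by (simp add: cip_def matrix_vector_mult_def sum_distrib_right sum_distrib_left adj_def mult_ac)
  finally show ?thesis .
qed

lemma cip_commute: "cip y x = cnj (cip x y)"
  by (simp add: cip_def mult.commute)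

lemma cip_self: "cip x x = complex_of_real ((norm x)\<^sup>2)"
proof -
  have "Im (cip x x) = 0" by (simp add: cip_def)
  moreover have "Re (cip x x) = (norm x)\<^sup>2" by (simp add: Re_cip power2_norm_eq_inner)
  ultimately show ?thesis by (simp add: complex_eq_iff)
qed

lemma cip_linear: "cip x (y + z) = cip x y + cip x z" "cip x (y - z) = cip x y - cip x z"
  "cip x (c *\<^sub>R y) = c *\<^sub>R cip x y" "cip (c *\<^sub>R x) y = c *\<^sub>R cip x y"
  by (simp_all add: cip_def algebra_simps sum.distrib sum_subtractf scaleR_sum_right)

lemma scaleR_matrix_vector: "(c *\<^sub>R A) *v x = c *\<^sub>R ((A :: complex^'n^'m) *v x)"
  by (simp add: vec_eq_iff matrix_vector_mult_def scaleR_sum_right)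

lemma matrix_vector_scaleR: "A *v (c *\<^sub>R x) = c *\<^sub>R ((A :: complex^'n^'m) *v x)"
  by (simp add: vec_eq_iff matrix_vector_mult_def scaleR_sum_right)

lemma herm_form_simps:
  "herm_form (A + B) x = herm_form A x + herm_form B x"
  "herm_form (A - B) x = herm_form A x - herm_form B x"
  "herm_form (c *\<^sub>R A) x = c *\<^sub>R herm_form A x"
  "herm_form (mat 1) x = complex_of_real ((norm x)\<^sup>2)"
  by (simp_all add: herm_form_cip matrix_vector_mult_add_rdistrib
      matrix_vector_mult_diff_rdistrib cip_linear cip_self scaleR_matrix_vector)

lemma herm_form_congruence: "herm_form (U ** M ** adj U) x = herm_form M (adj U *v x)"
  by (simp add: herm_form_cip cip_adj matrix_vector_mul_assoc[symmetric])

lemma pos_def_imp_nonneg: "pos_def_hermitian M \<Longrightarrow> nonneg_hermitian M"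
  unfolding pos_def_hermitian_def nonneg_hermitian_def
  by (metis herm_form_cip cip_linear(4) less_eq_real_def matrix_vector_mult_0_right scaleR_zero_left
      zero_complex.simps(1))

lemma nonneg_hermitianD: "nonneg_hermitian M \<Longrightarrow> adj M = M"
  by (simp add: nonneg_hermitian_def hermitian_def)

lemma pos_def_hermitianD: "pos_def_hermitian M \<Longrightarrow> adj M = M"
  by (simp add: pos_def_hermitian_def hermitian_def)

lemma pos_def_one: "pos_def_hermitian (mat 1)"
  by (simp add: pos_def_hermitian_def hermitian_def herm_form_simps)

lemma nonneg_zero: "nonneg_hermitian 0"
  by (simp add: nonneg_hermitian_def hermitian_def herm_form_def)

lemma nonneg_add: "nonneg_hermitian A \<Longrightarrow> nonneg_hermitian B \<Longrightarrow> nonneg_hermitian (A + B)"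
  by (simp add: nonneg_hermitian_def hermitian_def herm_form_simps adj_simps)

lemma nonneg_scaleR: "nonneg_hermitian A \<Longrightarrow> 0 \<le> c \<Longrightarrow> nonneg_hermitian (c *\<^sub>R A)"
  by (simp add: nonneg_hermitian_def hermitian_def herm_form_simps adj_simps)

lemma pos_def_add: "pos_def_hermitian A \<Longrightarrow> nonneg_hermitian B \<Longrightarrow> pos_def_hermitian (A + B)"
  by (simp add: nonneg_hermitian_def pos_def_hermitian_def hermitian_def herm_form_simps adj_simps
      add_pos_nonneg)

lemma pos_def_scaleR: "pos_def_hermitian A \<Longrightarrow> 0 < c \<Longrightarrow> pos_def_hermitian (c *\<^sub>R A)"
  by (simp add: pos_def_hermitian_def hermitian_def herm_form_simps adj_simps)

lemma nonneg_congruence: "nonneg_hermitian M \<Longrightarrow> nonneg_hermitian (U ** M ** adj U)"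
  by (simp add: nonneg_hermitian_def hermitian_def herm_form_congruence adj_simps matrix_mul_assoc)

lemma nonneg_congruence': "nonneg_hermitian M \<Longrightarrow> nonneg_hermitian (adj U ** M ** U)"
  using nonneg_congruence[of M "adj U"] by simp

lemma nonneg_gram: "nonneg_hermitian (U ** adj U)"
  using nonneg_congruence[OF pos_def_imp_nonneg[OF pos_def_one], of U] by simp

lemma pos_def_invertible:
  assumes "pos_def_hermitian M"
  shows "invertible M"
proof -
  have "x = 0" if "M *v x = 0" for x
  proof (rule ccontr)
    assume "x \<noteq> 0"
    then have "0 < Re (herm_form M x)" using assms by (simp add: pos_def_hermitian_def)
    then show False using that by (simp add: herm_form_def)
  qed
  then show ?thesis
    by (simp add: invertible_left_inverse matrix_left_invertible_ker)
qed

lemma pos_def_nonzero: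
  fixes M :: "complex^'n^'n"
  assumes "pos_def_hermitian M"
  shows "M \<noteq> 0"
proof
  assume "M = 0"
  moreover have "(axis undefined 1 :: complex^'n) \<noteq> 0" by (simp add: axis_eq_0_iff)
  ultimately have "0 < Re (herm_form 0 (axis undefined 1 :: complex^'n))"
    using assms unfolding pos_def_hermitian_def by blast
  then show False by (simp add: herm_form_def)
qed

lemma pos_def_congruence:
  fixes U M :: "complex^'n^'n"
  assumes "pos_def_hermitian M" "invertible U"
  shows "pos_def_hermitian (U ** M ** adj U)"
proof -
  have "adj U *v x \<noteq> 0" if "x \<noteq> 0" for x
    using invertible_adj[OF assms(2)] that
    by (auto simp: invertible_left_inverse matrix_left_invertible_ker)
  then show ?thesis using assms(1)
    by (simp add: pos_def_hermitian_def hermitian_def herm_form_congruence adj_simps matrix_mul_assoc)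
qed

lemma pos_def_inverse:
  assumes "pos_def_hermitian M"
  shows "pos_def_hermitian (matrix_inv M)"
proof -
  have inv: "invertible M" by (rule pos_def_invertible[OF assms])
  have a: "adj (matrix_inv M) = matrix_inv M"
    using adj_matrix_inv[OF inv] pos_def_hermitianD[OF assms] by simp
  have "invertible (matrix_inv M)"
    using matrix_inv_mult[OF inv] unfolding invertible_def by blast
  from pos_def_congruence[OF assms this] show ?thesis
    by (simp add: a matrix_inv_mult[OF inv])
qed

section \<open>The spectral theorem and its consequences\<close>

lemma matrix_vector_mult_continuous:
  "continuous_on S (\<lambda>x. (M :: complex^'n^'m) *v x)"
  by (rule linear_continuous_on) (simp add: linear_linear)

lemma hermitian_inner:
  assumes "adj M = M"
  shows "inner x (M *v y) = inner (M *v x) y"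
  using cip_adj[of x M y] assms by (simp flip: Re_cip)

text \<open>The induction step of the spectral theorem. The orthogonal complement \<open>W\<close> of the
  eigenvectors found so far is nonzero and invariant under \<open>M\<close>. A maximizer \<open>x\<close> of the quadratic
  form on its unit sphere is an eigenvector: with \<open>r\<close> the maximum, \<open>g y = r \<parallel>y\<parallel>\<^sup>2 - y\<^sup>H M y\<close> is
  nonnegative on \<open>W\<close> and vanishes at \<open>x\<close>, so moving from \<open>x\<close> along \<open>-z\<close>, where
  \<open>z = r x - M x \<in> W\<close>, would make \<open>g\<close> negative unless \<open>z = 0\<close>.\<close>

lemma orthogonal_eigenvector:
  fixes M :: "complex^'n^'n" and v :: "'n \<Rightarrow> complex^'n" and l :: "'n \<Rightarrow> real"
  assumes M: "adj M = M" and i: "i \<notin> I"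
    and eig: "\<forall>j\<in>I. M *v v j = l j *\<^sub>R v j"
  obtains x r where "norm x = 1" "\<forall>j\<in>I. cip (v j) x = 0" "M *v x = r *\<^sub>R x"
proof -
  define W where "W = {x. \<forall>j\<in>I. cip (v j) x = 0}"
  define B :: "complex^'n^'n" where "B = (\<chi> j k. if j \<in> I then cnj (v j $ k) else 0)"
  have BW: "x \<in> W" if "B *v x = 0" for x
  proof -
    have "cip (v j) x = (B *v x) $ j" if "j \<in> I" for j
      using that by (simp add: B_def cip_def matrix_vector_mult_def)
    then show ?thesis using that by (simp add: W_def)
  qed
  \<comment> \<open>Row \<open>i\<close> of \<open>B\<close> vanishes because \<open>i\<close> is a free index; this replaces a dimension count.\<close>
  have "det B = 0"
    by (rule det_zero_row[of i]) (use i in \<open>simp add: B_def row_def vec_eq_iff\<close>)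
  then have "\<not> invertible B" by (simp add: invertible_det_nz)
  then obtain w where w: "B *v w = 0" "w \<noteq> 0"
    by (auto simp: invertible_left_inverse matrix_left_invertible_ker)
  have Wscale: "c *\<^sub>R x \<in> W" if "x \<in> W" for c x
    using that by (simp add: W_def cip_linear)
  define Sp where "Sp = W \<inter> sphere 0 1"
  have "(1 / norm w) *\<^sub>R w \<in> Sp"
    using Wscale[OF BW[OF w(1)]] w(2) by (simp add: Sp_def)
  then have ne: "Sp \<noteq> {}" by blast
  have "W = (\<Inter>j\<in>I. {x. cip (v j) x = 0})" by (auto simp: W_def)
  moreover have "closed {x. cip (v j) x = 0}" for j
    unfolding cip_def by (intro closed_Collect_eq continuous_intros)
  ultimately have "closed W" by auto
  then have "compact Sp" unfolding Sp_def by (intro closed_Int_compact) auto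
  moreover have "continuous_on Sp (\<lambda>x. inner x (M *v x))"
    by (intro continuous_intros matrix_vector_mult_continuous)
  ultimately obtain x where x: "x \<in> Sp" and mx: "\<And>y. y \<in> Sp \<Longrightarrow> inner y (M *v y) \<le> inner x (M *v x)"
    using continuous_attains_sup[OF _ ne] by metis
  define r where "r = inner x (M *v x)"
  define g where "g y = r * (norm y)\<^sup>2 - inner y (M *v y)" for y
  have xW: "x \<in> W" and nx: "norm x = 1" using x by (auto simp: Sp_def)
  have g0: "0 \<le> g y" if "y \<in> W" for y
  proof (cases "y = 0")
    case True then show ?thesis by (simp add: g_def)
  next
    case False
    have "(1 / norm y) *\<^sub>R y \<in> Sp" using Wscale[OF that] False by (simp add: Sp_def)
    from mx[OF this] have "inner y (M *v y) / (norm y)\<^sup>2 \<le> r"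
      by (simp add: r_def matrix_vector_scaleR power2_eq_square)
    then show ?thesis using False by (simp add: g_def field_simps)
  qed
  define z where "z = r *\<^sub>R x - M *v x"
  have zW: "z \<in> W"
  proof -
    have "cip (v j) (M *v x) = 0" if "j \<in> I" for j
      using cip_adj[of "v j" M x] eig xW that by (simp add: M cip_linear W_def)
    then show ?thesis using xW by (simp add: z_def W_def cip_linear)
  qed
  have bound: "2 * (norm z)\<^sup>2 \<le> e * g z" if "e > 0" for e :: real
  proof -
    have "x - e *\<^sub>R z \<in> W" using Wscale[OF zW] xW by (simp add: W_def cip_linear)
    then have "0 \<le> g (x - e *\<^sub>R z)" by (rule g0)
    moreover have "g (x - e *\<^sub>R z) = e * (e * g z - 2 * (norm z)\<^sup>2)"
    proof -
      have xx: "inner x x = 1" using nx by (simp flip: power2_norm_eq_inner)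
      have zMx: "inner z (M *v x) = r * inner z x - inner z z"
        by (simp add: z_def inner_diff_left inner_diff_right algebra_simps)
      have xMz: "inner x (M *v z) = r * inner z x - inner z z"
        using zMx hermitian_inner[OF M, of x z] by (simp add: inner_commute)
      have xMx: "inner x (M *v x) = r" by (simp add: r_def)
      show ?thesis
        unfolding g_def power2_norm_eq_inner
        by (simp add: matrix_vector_mult_diff_distrib matrix_vector_scaleR inner_diff_left
            inner_diff_right zMx xMz xMx xx inner_commute[of x z] algebra_simps)
    qed
    ultimately show ?thesis using that by (simp add: zero_le_mult_iff)
  qed
  have "(norm z)\<^sup>2 \<le> 0"
  proof (rule field_le_epsilon)
    fix e :: real assume e: "e > 0"
    define e' where "e' = e / (1 + \<bar>g z\<bar>)"
    have "e' > 0" using e by (simp add: e'_def)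
    then have "2 * (norm z)\<^sup>2 \<le> e' * g z" by (rule bound)
    also have "\<dots> \<le> e' * (1 + \<bar>g z\<bar>)" using \<open>e' > 0\<close> by (intro mult_left_mono) auto
    also have "\<dots> = e" by (simp add: e'_def add_pos_nonneg)
    finally show "(norm z)\<^sup>2 \<le> 0 + e" using e
      by (smt (verit) zero_le_power2)
  qed
  then have "M *v x = r *\<^sub>R x" by (simp add: z_def)
  then show ?thesis using that nx xW by (auto simp: W_def)
qed

definition diagr :: "('n \<Rightarrow> real) \<Rightarrow> complex^'n^'n"
  where "diagr l = (\<chi> i j. if i = j then complex_of_real (l i) else 0)"

lemma adj_diagr [simp]: "adj (diagr l) = diagr l"
  by (auto simp: adj_def diagr_def vec_eq_iff)

lemma mult_diagr_component: "(A ** diagr l) $ i $ j = A $ i $ j * complex_of_real (l j)"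
  by (simp add: matrix_matrix_mult_def diagr_def if_distrib cong: if_cong)

lemma diagr_mult_component: "(diagr l ** A) $ i $ j = complex_of_real (l i) * A $ i $ j"
  by (simp add: matrix_matrix_mult_def diagr_def if_distrib[of "\<lambda>x. x * _"] cong: if_cong)

lemma diagr_mult: "diagr l ** diagr m = diagr (\<lambda>i. l i * m i)"
  by (simp add: vec_eq_iff mult_diagr_component) (simp add: diagr_def)

lemma diagr_linear: "diagr l + diagr m = diagr (\<lambda>i. l i + m i)"
  "diagr l - diagr m = diagr (\<lambda>i. l i - m i)" "c *\<^sub>R diagr l = diagr (\<lambda>i. c * l i)"
  by (auto simp: vec_eq_iff diagr_def) (simp add: scaleR_conv_of_real)

lemma mat_diagr: "mat 1 = diagr (\<lambda>_. 1)"
  by (simp add: vec_eq_iff diagr_def mat_def)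

lemma trace_diagr: "trace (diagr l) = complex_of_real (\<Sum>i\<in>UNIV. l i)"
  by (simp add: trace_def diagr_def)

lemma det_diagr: "det (diagr l) = complex_of_real (\<Prod>i\<in>UNIV. l i)"
  by (subst det_diagonal) (simp_all add: diagr_def)

lemma herm_form_diagr: "herm_form (diagr l) x = (\<Sum>i\<in>UNIV. complex_of_real (l i * (cmod (x $ i))\<^sup>2))"
proof -
  have "(diagr l *v x) $ i = complex_of_real (l i) * x $ i" for i
    by (simp add: matrix_vector_mult_def diagr_def if_distrib[of "\<lambda>x. x * _"] cong: if_cong)
  then show ?thesis
    by (simp add: herm_form_def complex_norm_square mult_ac del: of_real_power)
qed

lemma nonneg_diagr:
  fixes l :: "'n::finite \<Rightarrow> real"
  shows "nonneg_hermitian (diagr l) \<longleftrightarrow> (\<forall>i. 0 \<le> l i)"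
proof
  assume *: "nonneg_hermitian (diagr l)"
  show "\<forall>i. 0 \<le> l i"
  proof
    fix i :: 'n
    have ax: "(cmod ((axis i 1 :: complex^'n) $ j))\<^sup>2 = (if j = i then 1 else 0)" for j
      by (simp add: axis_def)
    have "Re (herm_form (diagr l) (axis i 1)) = (\<Sum>j\<in>UNIV. l j * (if j = i then 1 else 0))"
      by (simp add: herm_form_diagr ax del: of_real_mult)
    also have "\<dots> = l i" by (simp add: if_distrib cong: if_cong)
    finally have "Re (herm_form (diagr l) (axis i 1)) = l i" .
    then show "0 \<le> l i" using * by (metis nonneg_hermitian_def)
  qed
qed (simp add: nonneg_hermitian_def hermitian_def herm_form_diagr sum_nonneg)

theorem spectral:
  fixes M :: "complex^'n^'n"
  assumes "adj M = M"
  obtains U :: "complex^'n^'n" and l where "adj U ** U = mat 1" "U ** adj U = mat 1" "M = U ** diagr l ** adj U"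
proof -
  have "\<exists>v l. \<forall>i\<in>I. M *v v i = l i *\<^sub>R v i \<and> (\<forall>j\<in>I. cip (v i) (v j) = (if i = j then 1 else 0))"
    if "finite I" for I :: "'n set"
    using that
  proof induction
    case (insert i I)
    then obtain v :: "'n \<Rightarrow> complex^'n" and l :: "'n \<Rightarrow> real" where
      vl: "\<And>i. i \<in> I \<Longrightarrow> M *v v i = l i *\<^sub>R v i"
      "\<And>i j. i \<in> I \<Longrightarrow> j \<in> I \<Longrightarrow> cip (v i) (v j) = (if i = j then 1 else 0)"
      by blast
    have "\<forall>j\<in>I. M *v v j = l j *\<^sub>R v j" using vl(1) by blast
    then obtain x r where x: "norm x = 1" "\<forall>j\<in>I. cip (v j) x = 0" "M *v x = r *\<^sub>R x"
      using orthogonal_eigenvector[OF assms insert.hyps(2)] by blast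
    have x': "cip x (v j) = 0" if "j \<in> I" for j using x(2) that cip_commute[of x "v j"] by simp
    have xx: "cip x x = 1" using x(1) by (simp add: cip_self)
    show ?case
      by (rule exI[of _ "v(i := x)"], rule exI[of _ "l(i := r)"])
        (use vl x x' xx insert.hyps in auto)
  qed simp
  from this[OF finite_class.finite_UNIV] obtain v :: "'n \<Rightarrow> complex^'n" and l :: "'n \<Rightarrow> real" where
      vl: "\<And>i. M *v v i = l i *\<^sub>R v i"
      "\<And>i j. cip (v i) (v j) = (if i = j then 1 else 0)"
    by blast
  define U :: "complex^'n^'n" where "U = (\<chi> k j. v j $ k)"
  have UU: "adj U ** U = mat 1"
    using vl(2) by (simp add: vec_eq_iff matrix_matrix_mult_def adj_def U_def cip_def mat_def)
  then have UU': "U ** adj U = mat 1" using matrix_left_right_inverse by blast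
  have "(M ** U) $ k $ j = (U ** diagr l) $ k $ j" for k j
  proof -
    have "(M ** U) $ k $ j = (M *v v j) $ k"
      by (simp add: matrix_matrix_mult_def matrix_vector_mult_def U_def)
    then show ?thesis
      by (simp add: vl(1) mult_diagr_component U_def) (simp add: scaleR_conv_of_real)
  qed
  then have "M ** U = U ** diagr l" by (simp add: vec_eq_iff)
  then have "M = U ** diagr l ** adj U"
    by (metis UU' matrix_mul_assoc matrix_mul_rid)
  with UU UU' show ?thesis by (rule that)
qed

lemma nonneg_spectral:
  fixes M :: "complex^'n^'n"
  assumes "nonneg_hermitian M"
  obtains U :: "complex^'n^'n" and l where "adj U ** U = mat 1" "U ** adj U = mat 1" "M = U ** diagr l ** adj U"
    "\<And>i. 0 \<le> l i"
proof -
  obtain U :: "complex^'n^'n" and l where U: "adj U ** U = mat 1" "U ** adj U = mat 1" "M = U ** diagr l ** adj U"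
    using spectral[OF nonneg_hermitianD[OF assms]] by blast
  have "adj U ** M ** U = (adj U ** U) ** diagr l ** (adj U ** U)"
    by (simp only: U(3) matrix_mul_assoc)
  then have "adj U ** M ** U = diagr l" by (simp add: U(1))
  with nonneg_congruence'[OF assms, of U] have "nonneg_hermitian (diagr l)" by simp
  then show ?thesis using that U by (simp add: nonneg_diagr)
qed

lemma nonneg_sqrt_exists:
  fixes M :: "complex^'n^'n"
  assumes "nonneg_hermitian M"
  obtains S :: "complex^'n^'n" where "nonneg_hermitian S" "S ** S = M"
proof -
  obtain U :: "complex^'n^'n" and l where U: "adj U ** U = mat 1" "U ** adj U = mat 1" "M = U ** diagr l ** adj U" "\<And>i. 0 \<le> l i"
    using nonneg_spectral[OF assms] by blast
  define S where "S = U ** diagr (\<lambda>i. sqrt (l i)) ** adj U"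
  have "nonneg_hermitian S"
    unfolding S_def by (intro nonneg_congruence) (simp add: nonneg_diagr U(4))
  moreover have "S ** S = U ** diagr (\<lambda>i. sqrt (l i)) ** (adj U ** U) ** diagr (\<lambda>i. sqrt (l i)) ** adj U"
    by (simp only: S_def matrix_mul_assoc)
  then have "S ** S = U ** (diagr (\<lambda>i. sqrt (l i)) ** diagr (\<lambda>i. sqrt (l i))) ** adj U"
    by (simp add: U(1) matrix_mul_assoc)
  then have "S ** S = M" by (simp add: diagr_mult U)
  ultimately show ?thesis using that by blast
qed

text \<open>From \<open>S\<^sup>2 = T\<^sup>2\<close> one gets \<open>S (S - T) + (S - T) T = 0\<close>. In an eigenbasis of the Hermitian matrix
  \<open>S - T\<close> the diagonal of this equation reads \<open>l\<^sub>i (S\<^sub>i\<^sub>i + T\<^sub>i\<^sub>i) = 0\<close>, while \<open>l\<^sub>i = S\<^sub>i\<^sub>i - T\<^sub>i\<^sub>i\<close> with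
  nonnegative \<open>S\<^sub>i\<^sub>i\<close> and \<open>T\<^sub>i\<^sub>i\<close>; so every eigenvalue of the difference vanishes.\<close>

lemma nonneg_sqrt_unique:
  fixes S T :: "complex^'n^'n"
  assumes S: "nonneg_hermitian S" and T: "nonneg_hermitian T" and eq: "S ** S = T ** T"
  shows "S = T"
proof -
  have "adj (S - T) = S - T" using S T by (simp add: adj_simps nonneg_hermitianD)
  then obtain U :: "complex^'n^'n" and l where U: "adj U ** U = mat 1" "U ** adj U = mat 1" "S - T = U ** diagr l ** adj U"
    by (rule spectral)
  define S' where "S' = adj U ** S ** U"
  define T' where "T' = adj U ** T ** U"
  have nn: "nonneg_hermitian S'" "nonneg_hermitian T'"
    using S T by (simp_all add: S'_def T'_def nonneg_congruence')
  have diag: "0 \<le> Re (X $ i $ i)" if "nonneg_hermitian X" for X :: "complex^'n^'n" and i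
  proof -
    have "cip (axis i 1) y = y $ i" for y :: "complex^'n"
    proof -
      have "cnj ((axis i 1 :: complex^'n) $ j) * y $ j = (if j = i then y $ j else 0)" for j
        by (simp add: axis_def)
      then show ?thesis by (simp add: cip_def)
    qed
    moreover have "X $ i $ j * (axis i 1 :: complex^'n) $ j = (if j = i then X $ i $ j else 0)" for j
      by (simp add: axis_def)
    then have "(X *v axis i 1) $ i = X $ i $ i" by (simp add: matrix_vector_mult_def)
    ultimately have "herm_form X (axis i 1) = X $ i $ i" by (simp add: herm_form_cip)
    then show ?thesis using that by (metis nonneg_hermitian_def)
  qed
  have "S' - T' = adj U ** (S - T) ** U" by (simp add: S'_def T'_def mat_ring)
  also have "\<dots> = (adj U ** U) ** diagr l ** (adj U ** U)"
    by (simp only: U(3) matrix_mul_assoc)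
  finally have diff: "S' - T' = diagr l" by (simp add: U(1))
  have "S' ** S' = adj U ** S ** (U ** adj U) ** S ** U" by (simp only: S'_def matrix_mul_assoc)
  moreover have "T' ** T' = adj U ** T ** (U ** adj U) ** T ** U" by (simp only: T'_def matrix_mul_assoc)
  ultimately have "S' ** S' = T' ** T'"
    using eq by (simp add: U(2)) (simp add: matrix_mul_assoc[symmetric])
  then have "S' ** (S' - T') + (S' - T') ** T' = 0" by (simp add: mat_ring)
  then have zero: "(S' ** diagr l + diagr l ** T') $ i $ i = 0" for i by (simp add: diff)
  have "l i = 0" for i
  proof -
    have "(S' - T') $ i $ i = complex_of_real (l i)" by (simp only: diff) (simp add: diagr_def)
    then have d: "Re (S' $ i $ i) - Re (T' $ i $ i) = l i" by (simp add: complex_eq_iff)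
    have "complex_of_real (l i) * (S' $ i $ i + T' $ i $ i) = 0"
      using zero[of i] by (simp add: mult_diagr_component diagr_mult_component algebra_simps)
    then have "l i = 0 \<or> S' $ i $ i + T' $ i $ i = 0" by simp
    moreover have "l i = 0" if "S' $ i $ i + T' $ i $ i = 0"
    proof -
      have "Re (S' $ i $ i) + Re (T' $ i $ i) = 0" using that by (simp add: complex_eq_iff)
      then show ?thesis using diag[OF nn(1), of i] diag[OF nn(2), of i] d by linarith
    qed
    ultimately show ?thesis by blast
  qed
  then have "diagr l = (0 :: complex^'n^'n)" by (simp add: diagr_def vec_eq_iff)
  then have "S - T = 0" by (simp add: U(3))
  then show ?thesis by simp
qed

lemma msqrt_eqI:
  assumes "nonneg_hermitian S" "S ** S = M"
  shows "msqrt M = S"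
  unfolding msqrt_def by (rule the_equality) (use assms nonneg_sqrt_unique in \<open>auto\<close>)

lemma msqrt:
  assumes "nonneg_hermitian M"
  shows nonneg_msqrt: "nonneg_hermitian (msqrt M)" and msqrt_square: "msqrt M ** msqrt M = M"
proof -
  obtain S where "nonneg_hermitian S" "S ** S = M" using nonneg_sqrt_exists[OF assms] by blast
  with msqrt_eqI[OF this] show "nonneg_hermitian (msqrt M)" "msqrt M ** msqrt M = M" by simp_all
qed

text \<open>With \<open>S\<close> the square root of \<open>R\<close> and \<open>U\<close> the eigenvectors of \<open>S\<^sup>-\<^sup>1 P S\<^sup>-\<^sup>1\<close>, take \<open>T = S U\<close>.
  Determinants and traces involving \<open>P\<close> and \<open>R\<close> then become sums over the numbers \<open>p\<close>, which
  reduces the matrix inequalities below to scalar ones.\<close>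

lemma simultaneous_diagonalization:
  fixes P R :: "complex^'n^'n"
  assumes R: "pos_def_hermitian R" and P: "adj P = P"
  obtains T :: "complex^'n^'n" and p where "invertible T" "R = T ** adj T" "P = T ** diagr p ** adj T"
proof -
  obtain S where S: "nonneg_hermitian S" "S ** S = R"
    using nonneg_sqrt_exists[OF pos_def_imp_nonneg[OF R]] by blast
  have aS: "adj S = S" using S(1) by (rule nonneg_hermitianD)
  have "det S * det S \<noteq> 0"
    using pos_def_invertible[OF R] by (simp add: invertible_det_nz flip: S(2) det_mul)
  then have invS: "invertible S" by (simp add: invertible_det_nz)
  define S' where "S' = matrix_inv S"
  have S': "S ** S' = mat 1" "S' ** S = mat 1" using matrix_inv_mult[OF invS] by (simp_all add: S'_def)
  have aS': "adj S' = S'" unfolding S'_def using adj_matrix_inv[OF invS] aS by simp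
  have "adj (S' ** P ** S') = S' ** P ** S'" by (simp add: adj_simps aS' P matrix_mul_assoc)
  then obtain U :: "complex^'n^'n" and p where U: "adj U ** U = mat 1" "U ** adj U = mat 1" "S' ** P ** S' = U ** diagr p ** adj U"
    by (rule spectral)
  define T where "T = S ** U"
  have "P = (S ** S') ** P ** (S' ** S)" by (simp add: S')
  also have "\<dots> = S ** (S' ** P ** S') ** S" by (simp only: matrix_mul_assoc)
  also have "\<dots> = T ** diagr p ** adj T" by (simp only: U(3) T_def adj_simps aS matrix_mul_assoc)
  finally have "P = T ** diagr p ** adj T" .
  moreover have "T ** adj T = S ** (U ** adj U) ** S" by (simp only: T_def adj_simps aS matrix_mul_assoc)
  then have "R = T ** adj T" by (simp add: U(2) S(2))
  moreover have "invertible T"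
    unfolding T_def using U invS by (intro invertible_mult) (auto simp: invertible_def)
  ultimately show ?thesis using that by blast
qed

lemma congruence_diagr_nonneg:
  fixes T :: "complex^'n^'n"
  assumes "invertible T" "nonneg_hermitian (T ** diagr p ** adj T)"
  shows "0 \<le> p i"
proof -
  define T' where "T' = matrix_inv T"
  have T': "T' ** T = mat 1" unfolding T'_def by (rule matrix_inv_mult[OF assms(1)])
  then have aT': "adj T ** adj T' = mat 1" by (simp flip: adj_mult)
  have "T' ** (T ** diagr p ** adj T) ** adj T' = (T' ** T) ** diagr p ** (adj T ** adj T')"
    by (simp only: matrix_mul_assoc)
  then have "nonneg_hermitian (diagr p)"
    using nonneg_congruence[OF assms(2), of T'] by (simp add: T' aT')
  then show ?thesis by (simp add: nonneg_diagr)
qed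

lemma congruence_diagr_pos:
  fixes T :: "complex^'n^'n"
  assumes T: "invertible T" and M: "pos_def_hermitian (T ** diagr p ** adj T)"
  shows "0 < p i"
proof -
  have "invertible (T ** diagr p ** adj T)" by (rule pos_def_invertible[OF M])
  then have "(\<Prod>i\<in>UNIV. p i) \<noteq> 0" by (simp add: invertible_det_nz det_mul det_diagr)
  then have "p i \<noteq> 0" by simp
  moreover have "0 \<le> p i" by (rule congruence_diagr_nonneg[OF T pos_def_imp_nonneg[OF M]])
  ultimately show ?thesis by simp
qed

lemma congruence_inverse:
  fixes T :: "complex^'n^'n"
  assumes "invertible T" "\<And>i. p i \<noteq> 0"
  shows "matrix_inv (T ** diagr p ** adj T)
    = adj (matrix_inv T) ** diagr (\<lambda>i. 1 / p i) ** matrix_inv T"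
proof -
  define T' where "T' = matrix_inv T"
  have T': "T' ** T = mat 1" "T ** T' = mat 1" using matrix_inv_mult[OF assms(1)] by (simp_all add: T'_def)
  then have aT': "adj T ** adj T' = mat 1" by (simp flip: adj_mult)
  have "(T ** diagr p ** adj T) ** (adj T' ** diagr (\<lambda>i. 1 / p i) ** T')
    = T ** diagr p ** (adj T ** adj T') ** diagr (\<lambda>i. 1 / p i) ** T'"
    by (simp only: matrix_mul_assoc)
  also have "\<dots> = T ** (diagr p ** diagr (\<lambda>i. 1 / p i)) ** T'"
    by (simp add: aT' matrix_mul_assoc)
  also have "\<dots> = mat 1" using assms(2) by (simp add: diagr_mult T' flip: mat_diagr)
  finally show ?thesis unfolding T'_def by (rule matrix_inv_eq)
qed

lemma congruence_trace_inverse: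
  fixes T :: "complex^'n^'n"
  assumes "invertible T" "\<And>i. q i \<noteq> 0"
  shows "trace ((T ** diagr p ** adj T) ** matrix_inv (T ** diagr q ** adj T))
    = complex_of_real (\<Sum>i\<in>UNIV. p i / q i)"
proof -
  define T' where "T' = matrix_inv T"
  have T': "T' ** T = mat 1" using matrix_inv_mult[OF assms(1)] by (simp add: T'_def)
  then have aT': "adj T ** adj T' = mat 1" by (simp flip: adj_mult)
  have "(T ** diagr p ** adj T) ** matrix_inv (T ** diagr q ** adj T)
    = (T ** diagr p ** (adj T ** adj T') ** diagr (\<lambda>i. 1 / q i)) ** T'"
    by (simp only: congruence_inverse[OF assms] T'_def matrix_mul_assoc)
  also have "trace \<dots> = trace (T' ** (T ** diagr p ** diagr (\<lambda>i. 1 / q i)))"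
    by (subst trace_mul_sym) (simp add: aT')
  also have "T' ** (T ** diagr p ** diagr (\<lambda>i. 1 / q i)) = (T' ** T) ** (diagr p ** diagr (\<lambda>i. 1 / q i))"
    by (simp only: matrix_mul_assoc)
  finally show ?thesis by (simp add: T' diagr_mult trace_diagr)
qed

lemma congruence_det:
  fixes T :: "complex^'n^'n"
  shows "det (T ** diagr p ** adj T) = complex_of_real ((cmod (det T))\<^sup>2 * (\<Prod>i\<in>UNIV. p i))"
  by (simp add: det_mul det_adj det_diagr complex_norm_square mult_ac del: of_real_power)

lemma trace_nonneg_inverse_pos:
  fixes X Y :: "complex^'n^'n"
  assumes X: "nonneg_hermitian X" "X \<noteq> 0" and Y: "pos_def_hermitian Y"
  shows "0 < Re (trace (X ** matrix_inv Y))"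
proof -
  obtain T :: "complex^'n^'n" and p where T: "invertible T" "Y = T ** adj T" "X = T ** diagr p ** adj T"
    using simultaneous_diagonalization[OF Y nonneg_hermitianD[OF X(1)]] by blast
  have Y': "Y = T ** diagr (\<lambda>_. 1) ** adj T" by (simp add: T(2) flip: mat_diagr)
  have p: "0 \<le> p i" for i using congruence_diagr_nonneg[OF T(1), of p i] X(1) T(3) by simp
  have "\<exists>i. p i \<noteq> 0"
  proof (rule ccontr)
    assume "\<not> ?thesis"
    then have "diagr p = (0 :: complex^'n^'n)" by (simp add: diagr_def vec_eq_iff)
    then show False using X(2) T(3) by simp
  qed
  then obtain i where "p i \<noteq> 0" by blast
  then have "0 < p i" using p[of i] by simp
  then have "0 < (\<Sum>i\<in>UNIV. p i)" using p by (intro sum_pos2[of UNIV i]) simp_all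
  then show ?thesis
    unfolding T(3) Y' by (subst congruence_trace_inverse) (use T(1) in auto)
qed

lemma trace_hermitian_real:
  fixes X Y :: "complex^'n^'n"
  assumes "adj X = X" "adj Y = Y"
  shows "trace (X ** Y) = complex_of_real (Re (trace (X ** Y)))"
proof -
  have "cnj (trace (X ** Y)) = trace (X ** Y)"
    using trace_adj[of "X ** Y"] trace_mul_sym[of Y X] assms by (simp add: adj_mult)
  then show ?thesis by (simp add: complex_eq_iff)
qed

text \<open>In an eigenbasis of \<open>Y\<close> the matrix \<open>W = s\<^sup>-\<^sup>1 I - (s I + Y)\<^sup>-\<^sup>1\<close> is diagonal with nonnegative
  entries, and the trace of a product of two nonnegative matrices is nonnegative.\<close>

lemma trace_inverse_le:
  fixes X Y :: "complex^'n^'n"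
  assumes X: "nonneg_hermitian X" and Y: "nonneg_hermitian Y" and s: "0 < s"
  shows "Re (trace (X ** matrix_inv (s *\<^sub>R mat 1 + Y))) \<le> Re (trace X) / s"
proof -
  obtain U :: "complex^'n^'n" and l where U: "adj U ** U = mat 1" "U ** adj U = mat 1" "Y = U ** diagr l ** adj U"
    and l: "\<And>i. 0 \<le> l i"
    using nonneg_spectral[OF Y] by blast
  have pos: "0 < s + l i" for i using l[of i] s by simp
  then have nz: "s + l i \<noteq> 0" for i by (metis less_irrefl)
  have invU: "invertible U" using U invertible_def by blast
  have s1: "s *\<^sub>R mat 1 = U ** diagr (\<lambda>_. s) ** adj U"
  proof -
    have "diagr (\<lambda>_. s) = s *\<^sub>R (mat 1 :: complex^'n^'n)" by (simp add: mat_diagr diagr_linear)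
    then show ?thesis by (simp add: scaleR_mult_left scaleR_mult_right U)
  qed
  have sum: "s *\<^sub>R mat 1 + Y = U ** diagr (\<lambda>i. s + l i) ** adj U"
    by (simp add: s1 U(3) flip: diagr_linear) (simp add: mat_ring)
  have Uinv: "matrix_inv U = adj U" by (rule matrix_inv_eq[OF U(2)])
  have inv: "matrix_inv (s *\<^sub>R mat 1 + Y) = U ** diagr (\<lambda>i. 1 / (s + l i)) ** adj U"
    unfolding sum using congruence_inverse[OF invU, of "\<lambda>i. s + l i", OF nz]
    by (simp add: Uinv)
  define W where "W = U ** diagr (\<lambda>i. 1 / s - 1 / (s + l i)) ** adj U"
  have "nonneg_hermitian W" unfolding W_def
    by (intro nonneg_congruence) (use s pos l in \<open>simp add: nonneg_diagr frac_le\<close>)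
  then obtain S where S: "nonneg_hermitian S" "S ** S = W" using nonneg_sqrt_exists by blast
  have "trace (X ** W) = trace ((X ** S) ** S)" by (simp flip: S(2) add: matrix_mul_assoc)
  also have "\<dots> = trace (S ** X ** adj S)" unfolding nonneg_hermitianD[OF S(1)]
    by (subst trace_mul_sym) (simp add: matrix_mul_assoc)
  finally have "trace (X ** W) = trace (S ** X ** adj S)" .
  moreover have "0 \<le> Re (trace (S ** X ** adj S))"
  proof -
    obtain U' :: "complex^'n^'n" and l' where U': "adj U' ** U' = mat 1" "U' ** adj U' = mat 1" "S ** X ** adj S = U' ** diagr l' ** adj U'" "\<And>i. 0 \<le> l' i"
      using nonneg_spectral[OF nonneg_congruence[OF X]] by blast
    have "trace (U' ** diagr l' ** adj U') = trace (adj U' ** (U' ** diagr l'))" by (rule trace_mul_sym)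
    then show ?thesis by (simp add: U' matrix_mul_assoc trace_diagr sum_nonneg)
  qed
  moreover have "W = (1 / s) *\<^sub>R mat 1 - matrix_inv (s *\<^sub>R mat 1 + Y)"
  proof -
    have "diagr (\<lambda>_. 1 / s) = (1 / s) *\<^sub>R (mat 1 :: complex^'n^'n)" by (simp add: mat_diagr diagr_linear)
    then have "(1 / s) *\<^sub>R mat 1 = U ** diagr (\<lambda>_. 1 / s) ** adj U"
      by (simp add: scaleR_mult_left scaleR_mult_right U)
    then show ?thesis
      by (simp add: W_def inv flip: diagr_linear) (simp add: mat_ring)
  qed
  ultimately have "0 \<le> Re ((1 / s) *\<^sub>R trace X - trace (X ** matrix_inv (s *\<^sub>R mat 1 + Y)))"
    by (metis (no_types) matrix_diff_ldistrib matrix_mul_rid scaleR_mult_right trace_scaleR trace_sub)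
  then show ?thesis by simp
qed

section \<open>The log-determinant\<close>

definition logdet :: "complex^'n^'n \<Rightarrow> real"
  where "logdet M = ln (Re (det M))"

lemma logdet_congruence:
  fixes T :: "complex^'n^'n"
  assumes "invertible T" "\<And>i. 0 < p i"
  shows "logdet (T ** diagr p ** adj T) = 2 * ln (cmod (det T)) + (\<Sum>i\<in>UNIV. ln (p i))"
proof -
  have "det T \<noteq> 0" using assms(1) by (simp add: invertible_det_nz)
  moreover have "0 < (\<Prod>i\<in>UNIV. p i)" by (simp add: prod_pos assms(2))
  moreover have "p i \<noteq> 0" for i using assms(2)[of i] by simp
  ultimately show ?thesis unfolding logdet_def congruence_det
    using assms(2) by (simp add: ln_mult ln_realpow ln_prod del: of_real_prod of_real_mult of_real_power)
qed

lemma pos_def_det: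
  fixes M :: "complex^'n^'n"
  assumes "pos_def_hermitian M"
  shows "0 < Re (det M)" "det M = complex_of_real (Re (det M))"
proof -
  obtain T :: "complex^'n^'n" and p where T: "invertible T" "M = T ** diagr p ** adj T"
    using simultaneous_diagonalization[OF assms pos_def_hermitianD[OF assms]] by blast
  have p: "0 < p i" for i using congruence_diagr_pos[OF T(1), of p i] assms T(2) by simp
  have "det T \<noteq> 0" using T(1) by (simp add: invertible_det_nz)
  then show "0 < Re (det M)" unfolding T(2) congruence_det using p
    by (simp add: prod_pos del: of_real_prod of_real_mult of_real_power)
  show "det M = complex_of_real (Re (det M))" unfolding T(2) congruence_det by simp
qed

lemma logdet_mult:
  assumes "pos_def_hermitian X" "pos_def_hermitian Y" "det M = det X * det Y"
  shows "logdet M = logdet X + logdet Y"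
proof -
  have "Re (det M) = Re (det X) * Re (det Y)"
    using pos_def_det(2)[OF assms(1)] pos_def_det(2)[OF assms(2)]
    by (metis assms(3) Re_complex_of_real of_real_mult)
  then show ?thesis
    using pos_def_det(1)[OF assms(1)] pos_def_det(1)[OF assms(2)] by (simp add: logdet_def ln_mult)
qed

lemma logdet_scaleR:
  fixes M :: "complex^'n^'n"
  assumes M: "pos_def_hermitian M" and c: "0 < c"
  shows "logdet (c *\<^sub>R M) = real CARD('n) * ln c + logdet M"
proof -
  obtain T :: "complex^'n^'n" and p where T: "invertible T" "M = T ** diagr p ** adj T"
    using simultaneous_diagonalization[OF M pos_def_hermitianD[OF M]] by blast
  have p: "0 < p i" for i using congruence_diagr_pos[OF T(1), of p i] M T(2) by simp
  have cM: "c *\<^sub>R M = T ** diagr (\<lambda>i. c * p i) ** adj T"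
    by (simp add: T(2) scaleR_mult_left scaleR_mult_right flip: diagr_linear)
  show ?thesis
    unfolding cM unfolding T(2)
    using T(1) p c by (simp add: logdet_congruence ln_mult_pos sum.distrib)
qed

text \<open>Strict concavity of \<open>ln det\<close>, in the form of its tangent at \<open>Y\<close>. If \<open>Y = T T\<^sup>H\<close> and
  \<open>X = T diag(p) T\<^sup>H\<close>, both claims reduce to \<open>ln p \<le> p - 1\<close> with equality only at \<open>p = 1\<close>.\<close>

theorem logdet_tangent:
  fixes X Y :: "complex^'n^'n"
  assumes X: "pos_def_hermitian X" and Y: "pos_def_hermitian Y"
  shows "logdet X \<le> logdet Y + Re (trace ((X - Y) ** matrix_inv Y))"
    and "logdet X = logdet Y + Re (trace ((X - Y) ** matrix_inv Y)) \<Longrightarrow> X = Y"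
proof -
  obtain T :: "complex^'n^'n" and p where T: "invertible T" "Y = T ** adj T" "X = T ** diagr p ** adj T"
    using simultaneous_diagonalization[OF Y pos_def_hermitianD[OF X]] by blast
  have Y': "Y = T ** diagr (\<lambda>_. 1) ** adj T" by (simp add: T(2) flip: mat_diagr)
  have "diagr (\<lambda>i. p i - 1) = diagr p - (diagr (\<lambda>_. 1) :: complex^'n^'n)" by (simp add: diagr_linear)
  then have XY: "X - Y = T ** diagr (\<lambda>i. p i - 1) ** adj T"
    unfolding Y' T(3) by (simp add: mat_ring)
  have p: "0 < p i" for i using congruence_diagr_pos[OF T(1), of p i] X T(3) by simp
  have tr: "Re (trace ((X - Y) ** matrix_inv Y)) = (\<Sum>i\<in>UNIV. p i - 1)"
    unfolding XY unfolding Y' by (subst congruence_trace_inverse) (use T(1) in auto)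
  have ld: "logdet X = logdet Y + (\<Sum>i\<in>UNIV. ln (p i))"
    unfolding Y' T(3) using T(1) p by (simp add: logdet_congruence)
  have le: "ln (p i) \<le> p i - 1" for i using p[of i] by (rule ln_le_minus_one)
  show "logdet X \<le> logdet Y + Re (trace ((X - Y) ** matrix_inv Y))"
    unfolding tr ld by (simp add: sum_mono le)
  assume "logdet X = logdet Y + Re (trace ((X - Y) ** matrix_inv Y))"
  then have "(\<Sum>i\<in>UNIV. (p i - 1) - ln (p i)) = 0" unfolding tr ld by (simp add: sum_subtractf)
  then have "\<forall>i\<in>UNIV. (p i - 1) - ln (p i) = 0" using le
    by (subst (asm) sum_nonneg_eq_0_iff) auto
  then have "p i = 1" for i using ln_eq_minus_one[OF p[of i]] by simp
  then have "p = (\<lambda>_. 1)" by blast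
  then show "X = Y" unfolding Y' T(3) by simp
qed

text \<open>\<open>ln det (P + z R)\<close> is convex in \<open>ln z\<close>: after simultaneous diagonalization it is a constant
  plus a sum of terms \<open>ln (p + z)\<close> with \<open>p \<ge> 0\<close>, each convex in \<open>ln z\<close>, strictly if \<open>p > 0\<close>.
  The left-hand side is the tangent at \<open>z\<close>; the factor of \<open>ln (z' / z)\<close> is the derivative
  with respect to \<open>ln z\<close>.\<close>

theorem logdet_log_convex:
  fixes P R :: "complex^'n^'n"
  assumes P: "nonneg_hermitian P" and R: "pos_def_hermitian R" and z: "0 < z" "0 < z'"
  shows "logdet (P + z *\<^sub>R R) + z * Re (trace (R ** matrix_inv (P + z *\<^sub>R R))) * ln (z' / z)
      \<le> logdet (P + z' *\<^sub>R R)" (is ?ineq)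
    and "P \<noteq> 0 \<Longrightarrow> z' \<noteq> z \<Longrightarrow>
      logdet (P + z *\<^sub>R R) + z * Re (trace (R ** matrix_inv (P + z *\<^sub>R R))) * ln (z' / z)
      < logdet (P + z' *\<^sub>R R)"
proof -
  obtain T :: "complex^'n^'n" and p where T: "invertible T" "R = T ** adj T" "P = T ** diagr p ** adj T"
    using simultaneous_diagonalization[OF R nonneg_hermitianD[OF P]] by blast
  have R': "R = T ** diagr (\<lambda>_. 1) ** adj T" by (simp add: T(2) flip: mat_diagr)
  have p: "0 \<le> p i" for i using congruence_diagr_nonneg[OF T(1), of p i] P T(3) by simp
  have PR: "P + w *\<^sub>R R = T ** diagr (\<lambda>i. p i + w) ** adj T" for w
  proof -
    have "diagr (\<lambda>i. p i + w) = diagr p + w *\<^sub>R (mat 1 :: complex^'n^'n)"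
      by (simp add: mat_diagr diagr_linear)
    then show ?thesis by (simp add: T mat_ring)
  qed
  have pos: "0 < p i + w" if "0 < w" for i w using p[of i] that by simp
  have tr: "Re (trace (R ** matrix_inv (P + z *\<^sub>R R))) = (\<Sum>i\<in>UNIV. 1 / (p i + z))"
    unfolding PR unfolding R'
    by (subst congruence_trace_inverse) (use T(1) pos[OF z(1)] in \<open>auto simp: less_le\<close>)
  have ld: "logdet (P + w *\<^sub>R R) = 2 * ln (cmod (det T)) + (\<Sum>i\<in>UNIV. ln (p i + w))" if "0 < w" for w
    unfolding PR using T(1) pos[OF that] by (rule logdet_congruence)
  define g where "g i = ln (p i + z') - ln (p i + z) - z / (p i + z) * ln (z' / z)" for i
  have diff: "logdet (P + z' *\<^sub>R R) - (logdet (P + z *\<^sub>R R)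
      + z * Re (trace (R ** matrix_inv (P + z *\<^sub>R R))) * ln (z' / z)) = (\<Sum>i\<in>UNIV. g i)"
    unfolding tr ld[OF z(1)] ld[OF z(2)] g_def
    by (simp add: sum_subtractf sum_distrib_left sum_distrib_right)
  \<comment> \<open>\<open>g i\<close> is the defect in the concavity inequality of \<open>ln\<close> for the points \<open>1\<close> and \<open>z' / z\<close>
    with weights \<open>1 - c\<close> and \<open>c\<close>.\<close>
  have core: "0 \<le> g i \<and> (0 < p i \<longrightarrow> z' \<noteq> z \<longrightarrow> 0 < g i)" for i
  proof -
    define c where "c = z / (p i + z)"
    define u where "u = z' / z"
    have c: "0 < c" "c \<le> 1" and u: "0 < u" using z p[of i] pos[OF z(1), of i] by (auto simp: c_def u_def)
    define m where "m = 1 - c + c * u"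
    have "c * (p i + z) = z" "c * u * (p i + z) = z'"
      using z pos[OF z(1), of i] by (simp_all add: c_def u_def)
    then have "m * (p i + z) = p i + z'" by (simp add: m_def algebra_simps)
    then have m: "m = (p i + z') / (p i + z)" using pos[OF z(1), of i] by (simp add: eq_divide_eq)
    have m0: "0 < m" unfolding m using pos[OF z(1), of i] pos[OF z(2), of i] by simp
    have g: "g i = ln m - c * ln u"
      unfolding g_def m using pos[OF z(1), of i] pos[OF z(2), of i] by (simp add: ln_div c_def u_def)
    have i1: "ln (1 / m) \<le> 1 / m - 1" using m0 by (intro ln_le_minus_one) simp
    have i2: "ln (u / m) \<le> u / m - 1" using m0 u by (intro ln_le_minus_one) simp
    have lin: "(1 - c) * (1 / m - 1) + c * (u / m - 1) = 0"
      using m0 by (simp add: field_simps) (simp add: m_def algebra_simps)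
    have gg: "g i = - ((1 - c) * ln (1 / m) + c * ln (u / m))"
      unfolding g using m0 u by (simp add: ln_div algebra_simps)
    have b1: "(1 - c) * ln (1 / m) \<le> (1 - c) * (1 / m - 1)" using i1 c by (intro mult_left_mono) auto
    have b2: "c * ln (u / m) \<le> c * (u / m - 1)" using i2 c by (intro mult_left_mono) auto
    have "0 \<le> g i" unfolding gg using b1 b2 lin by linarith
    moreover have "0 < g i" if "0 < p i" "z' \<noteq> z"
    proof -
      have "c < 1" using that(1) z by (simp add: c_def)
      have "u \<noteq> 1" using that(2) z by (simp add: u_def)
      have "m \<noteq> u"
      proof
        assume "m = u"
        then have "(1 - c) * (1 - u) = 0" by (simp add: m_def algebra_simps)
        then show False using \<open>c < 1\<close> \<open>u \<noteq> 1\<close> by simp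
      qed
      then have "ln (u / m) \<noteq> u / m - 1" using ln_eq_minus_one[of "u / m"] m0 u by auto
      then have "ln (u / m) < u / m - 1" using i2 by simp
      then have "c * ln (u / m) < c * (u / m - 1)" using c by simp
      then show ?thesis unfolding gg using b1 lin by linarith
    qed
    ultimately show ?thesis by blast
  qed
  have "0 \<le> (\<Sum>i\<in>UNIV. g i)" using core by (simp add: sum_nonneg)
  then show ?ineq using diff by linarith
  assume P0: "P \<noteq> 0" and zz: "z' \<noteq> z"
  obtain i where "p i \<noteq> 0"
  proof -
    have "diagr p \<noteq> (0 :: complex^'n^'n)" using P0 T(3) by auto
    then show ?thesis using that by (auto simp: diagr_def vec_eq_iff split: if_splits)
  qed
  then have "0 < g i" using p[of i] core zz by auto
  also have "g i \<le> (\<Sum>i\<in>UNIV. g i)" by (rule member_le_sum) (use core in auto)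
  finally show "logdet (P + z *\<^sub>R R) + z * Re (trace (R ** matrix_inv (P + z *\<^sub>R R))) * ln (z' / z)
      < logdet (P + z' *\<^sub>R R)" using diff by linarith
qed

section \<open>Block matrices over a sum of index types\<close>

text \<open>The isometric embeddings of the two coordinate blocks. Expressing block matrices through
  them turns block computations into noncommutative ring algebra governed by the relations
  \<open>incl_orthonormal\<close>.\<close>

definition inl_mat :: "complex^'a^('a::finite + 'b::finite)"
  where "inl_mat = (\<chi> i j. if i = Inl j then 1 else 0)"

definition inr_mat :: "complex^'b^('a::finite + 'b::finite)"
  where "inr_mat = (\<chi> i j. if i = Inr j then 1 else 0)"

definition bdiag :: "complex^'a::finite^'a \<Rightarrow> complex^'b::finite^'b \<Rightarrow> complex^('a + 'b)^('a + 'b)"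
  where "bdiag X Y = inl_mat ** X ** adj inl_mat + inr_mat ** Y ** adj inr_mat"

lemma sum_UNIV_plus:
  "(\<Sum>i\<in>(UNIV :: ('a::finite + 'b::finite) set). f i) = (\<Sum>i\<in>UNIV. f (Inl i)) + (\<Sum>i\<in>UNIV. f (Inr i))"
  unfolding UNIV_Plus_UNIV[symmetric] by (subst sum.Plus) simp_all

lemma prod_UNIV_plus:
  "(\<Prod>i\<in>(UNIV :: ('a::finite + 'b::finite) set). f i) = (\<Prod>i\<in>UNIV. f (Inl i)) * (\<Prod>i\<in>UNIV. f (Inr i))"
  unfolding UNIV_Plus_UNIV[symmetric] by (subst prod.Plus) simp_all

lemma incl_components [simp]:
  "(inl_mat ** X) $ Inl i $ j = X $ i $ j" "(inl_mat ** X) $ Inr k $ j = 0"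
  "(inr_mat ** Y) $ Inl i $ j = 0" "(inr_mat ** Y) $ Inr k $ j = Y $ k $ j"
  "(X' ** adj inl_mat) $ j $ Inl i = X' $ j $ i" "(X' ** adj inl_mat) $ j $ Inr k = 0"
  "(Y' ** adj inr_mat) $ j $ Inl i = 0" "(Y' ** adj inr_mat) $ j $ Inr k = Y' $ j $ k"
  by (simp_all add: matrix_matrix_mult_def inl_mat_def inr_mat_def adj_def if_distrib[of cnj]
      if_distrib[of "\<lambda>x. x * _"] if_distrib[of "\<lambda>x. _ * x"] cong: if_cong)

lemma bdiag_components:
  "bdiag X Y $ Inl i $ Inl j = X $ i $ j" "bdiag X Y $ Inl i $ Inr l = 0"
  "bdiag X Y $ Inr k $ Inl j = 0" "bdiag X Y $ Inr k $ Inr l = Y $ k $ l"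
  by (simp_all add: bdiag_def)

lemma incl_orthonormal [simp]:
  "adj inl_mat ** (inl_mat :: complex^'a^('a + 'b)) = mat 1" "adj inr_mat ** (inr_mat :: complex^'b^('a + 'b)) = mat 1"
  "adj inl_mat ** (inr_mat :: complex^'b^('a + 'b)) = 0" "adj inr_mat ** (inl_mat :: complex^'a^('a + 'b)) = 0"
  by (auto simp: vec_eq_iff matrix_matrix_mult_def sum_UNIV_plus inl_mat_def inr_mat_def adj_def mat_def
      if_distrib[of cnj] if_distrib[of "\<lambda>x. x * _"] cong: if_cong)

lemma incl_cancel [simp]:
  "X ** adj inl_mat ** (inl_mat :: complex^'a^('a + 'b)) = X" "Y ** adj inr_mat ** (inr_mat :: complex^'b^('a + 'b)) = Y"
  "X ** adj inl_mat ** (inr_mat :: complex^'b^('a + 'b)) = 0" "Y ** adj inr_mat ** (inl_mat :: complex^'a^('a + 'b)) = 0"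
  by (simp_all flip: matrix_mul_assoc)

lemma bdiag_one [simp]: "bdiag (mat 1) (mat 1) = mat 1"
proof -
  have "bdiag (mat 1) (mat 1) $ p $ q = (mat 1 :: complex^('a + 'b)^('a + 'b)) $ p $ q" for p q
    by (cases p; cases q) (simp_all add: bdiag_components, simp_all add: mat_def)
  then show ?thesis by (simp add: vec_eq_iff)
qed

lemma bdiag_mult: "bdiag X Y ** bdiag X' Y' = bdiag (X ** X') (Y ** Y')"
  by (simp add: bdiag_def mat_ring)

lemma adj_bdiag: "adj (bdiag X Y) = bdiag (adj X) (adj Y)"
  by (simp add: bdiag_def adj_simps matrix_mul_assoc)

lemma bdiag_linear: "bdiag X Y + bdiag X' Y' = bdiag (X + X') (Y + Y')"
  "bdiag X Y - bdiag X' Y' = bdiag (X - X') (Y - Y')"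
  "c *\<^sub>R bdiag X Y = bdiag (c *\<^sub>R X) (c *\<^sub>R Y)"
  by (simp_all add: bdiag_def mat_ring scaleR_add_right)

lemma trace_bdiag: "trace (bdiag X Y) = trace X + trace Y"
  by (simp add: trace_def sum_UNIV_plus bdiag_components)

lemma bdiag_diagr: "bdiag (diagr l) (diagr m) = diagr (case_sum l m)"
proof -
  have "bdiag (diagr l) (diagr m) $ p $ q = diagr (case_sum l m) $ p $ q" for p q
    by (cases p; cases q) (simp_all add: bdiag_components, simp_all add: diagr_def)
  then show ?thesis by (simp add: vec_eq_iff)
qed

lemma nonneg_bdiag:
  assumes "nonneg_hermitian X" "nonneg_hermitian Y"
  shows "nonneg_hermitian (bdiag X Y)"
  unfolding bdiag_def by (intro nonneg_add nonneg_congruence assms)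

lemma pos_def_bdiag:
  assumes X: "pos_def_hermitian X" and Y: "pos_def_hermitian Y"
  shows "pos_def_hermitian (bdiag X Y)"
proof -
  have "nonneg_hermitian (bdiag X Y)" by (intro nonneg_bdiag pos_def_imp_nonneg X Y)
  moreover have "0 < Re (herm_form (bdiag X Y) x)" if "x \<noteq> 0" for x
  proof -
    have form: "herm_form (bdiag X Y) x = herm_form X (adj inl_mat *v x) + herm_form Y (adj inr_mat *v x)"
      by (simp add: bdiag_def herm_form_simps herm_form_congruence)
    have "x = bdiag (mat 1) (mat 1) *v x" by simp
    then have "x = inl_mat *v (adj inl_mat *v x) + inr_mat *v (adj inr_mat *v x)"
      by (simp add: bdiag_def matrix_vector_mult_add_rdistrib matrix_vector_mul_assoc)
    then have "adj inl_mat *v x \<noteq> 0 \<or> adj inr_mat *v x \<noteq> 0" using that by auto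
    moreover have "0 \<le> Re (herm_form X (adj inl_mat *v x))" "0 \<le> Re (herm_form Y (adj inr_mat *v x))"
      using pos_def_imp_nonneg[OF X] pos_def_imp_nonneg[OF Y] by (simp_all add: nonneg_hermitian_def)
    moreover have "adj inl_mat *v x \<noteq> 0 \<Longrightarrow> 0 < Re (herm_form X (adj inl_mat *v x))"
      "adj inr_mat *v x \<noteq> 0 \<Longrightarrow> 0 < Re (herm_form Y (adj inr_mat *v x))"
      using X Y by (simp_all add: pos_def_hermitian_def)
    ultimately show ?thesis unfolding form by (auto simp: add_pos_nonneg add_nonneg_pos)
  qed
  ultimately show ?thesis by (simp add: nonneg_hermitian_def pos_def_hermitian_def)
qed

lemma det_unitary_conj:
  fixes U :: "complex^'n^'n"
  assumes "U ** adj U = mat 1"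
  shows "det (U ** X ** adj U) = det X"
proof -
  have "det U * det (adj U) = 1" using arg_cong[OF assms, of det] by (simp add: det_mul)
  moreover have "det (U ** X ** adj U) = (det U * det (adj U)) * det X" by (simp add: det_mul)
  ultimately show ?thesis by simp
qed

text \<open>For Hermitian blocks the spectral theorem reduces this to diagonal matrices.\<close>

lemma det_bdiag:
  fixes X :: "complex^'a^'a" and Y :: "complex^'b^'b"
  assumes X: "adj X = X" and Y: "adj Y = Y"
  shows "det (bdiag X Y) = det X * det Y"
proof -
  obtain U :: "complex^'a^'a" and l where U: "adj U ** U = mat 1" "U ** adj U = mat 1" "X = U ** diagr l ** adj U"
    using spectral[OF X] by blast
  obtain W :: "complex^'b^'b" and m where W: "adj W ** W = mat 1" "W ** adj W = mat 1" "Y = W ** diagr m ** adj W"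
    using spectral[OF Y] by blast
  have "bdiag X Y = bdiag U W ** diagr (case_sum l m) ** adj (bdiag U W)"
    by (simp add: U(3) W(3) adj_bdiag bdiag_mult flip: bdiag_diagr)
  moreover have "bdiag U W ** adj (bdiag U W) = mat 1" by (simp add: adj_bdiag bdiag_mult U W)
  ultimately have "det (bdiag X Y) = det (diagr (case_sum l m))" by (simp add: det_unitary_conj)
  moreover have "det X = det (diagr l)" "det Y = det (diagr m)"
    unfolding U(3) W(3) using U(2) W(2) by (simp_all add: det_unitary_conj)
  ultimately show ?thesis by (simp add: det_diagr prod_UNIV_plus)
qed

text \<open>Conjugation by \<open>P\<close> maps \<open>I + N\<close> to \<open>I + 2 N = (I + N)\<^sup>2\<close>, so the determinant equals its own
  square; it is nonzero because \<open>I - N\<close> is an inverse. For a block triangular \<open>N\<close> a suitable \<open>P\<close>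
  is block diagonal with blocks \<open>I\<close> and \<open>2 I\<close>.\<close>

lemma det_unipotent:
  fixes N P :: "complex^'n^'n"
  assumes N: "N ** N = 0" and P: "invertible P" and PN: "P ** N = 2 *\<^sub>R (N ** P)"
  shows "det (mat 1 + N) = 1"
proof -
  have "(mat 1 + N) ** (mat 1 - N) = mat 1" by (simp add: mat_ring N)
  from arg_cong[OF this, of det] have "det (mat 1 + N) * det (mat 1 - N) = 1" by (simp add: det_mul)
  then have nz: "det (mat 1 + N) \<noteq> 0" by auto
  have "(mat 1 + N) ** (mat 1 + N) = mat 1 + 2 *\<^sub>R N" by (simp add: mat_ring N scaleR_2)
  moreover have "P ** (mat 1 + N) = (mat 1 + 2 *\<^sub>R N) ** P" by (simp add: mat_ring PN)
  ultimately have "P ** (mat 1 + N) = (mat 1 + N) ** (mat 1 + N) ** P" by simp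
  then have "det (P ** (mat 1 + N)) = det ((mat 1 + N) ** (mat 1 + N) ** P)" by simp
  then have "det P * det (mat 1 + N) = det (mat 1 + N) * det (mat 1 + N) * det P"
    by (simp only: det_mul)
  then show ?thesis using nz P by (simp add: invertible_det_nz)
qed

text \<open>The block matrix with rows \<open>(I, -U)\<close> and \<open>(U\<^sup>H, I)\<close> has a lower-upper and an upper-lower block
  factorization with unipotent factors; comparing the two middle factors gives the claim.\<close>

lemma det_sylvester:
  fixes U :: "complex^'n^'m"
  shows "det (mat 1 + U ** adj U) = det (mat 1 + adj U ** U)"
proof -
  define N1 :: "complex^('m + 'n)^('m + 'n)" where "N1 = - (inl_mat ** U ** adj inr_mat)"
  define N2 :: "complex^('m + 'n)^('m + 'n)" where "N2 = inr_mat ** adj U ** adj inl_mat"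
  have inv: "invertible (bdiag (c *\<^sub>R mat 1) (d *\<^sub>R mat 1) :: complex^('m + 'n)^('m + 'n))" if "c \<noteq> 0" "d \<noteq> 0" for c d
  proof -
    have "bdiag (c *\<^sub>R mat 1) (d *\<^sub>R mat 1) ** bdiag ((1 / c) *\<^sub>R mat 1) ((1 / d) *\<^sub>R mat 1)
      = (mat 1 :: complex^('m + 'n)^('m + 'n))"
      using that by (simp add: bdiag_mult mat_ring)
    then show ?thesis by (auto simp: invertible_right_inverse)
  qed
  have d1: "det (mat 1 + N1) = 1"
    by (rule det_unipotent[OF _ inv[of 2 1]]) (simp_all add: N1_def bdiag_def mat_ring)
  have d2: "det (mat 1 + N2) = 1"
    by (rule det_unipotent[OF _ inv[of 1 2]]) (simp_all add: N2_def bdiag_def mat_ring)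
  have "(mat 1 + N2) ** bdiag (mat 1 :: complex^'m^'m) (mat 1 + adj U ** U) ** (mat 1 + N1)
    = (mat 1 + N1) ** bdiag (mat 1 + U ** adj U) (mat 1 :: complex^'n^'n) ** (mat 1 + N2)"
    by (simp add: N1_def N2_def bdiag_def mat_ring)
  from arg_cong[OF this, of det]
  have "det (bdiag (mat 1 :: complex^'m^'m) (mat 1 + adj U ** U))
    = det (bdiag (mat 1 + U ** adj U) (mat 1 :: complex^'n^'n))"
    by (simp add: det_mul d1 d2)
  then show ?thesis by (simp add: det_bdiag adj_simps)
qed

text \<open>Factoring \<open>X = T T\<^sup>H\<close> pulls out \<open>det X\<close> and leaves \<open>det (I + Z Z\<^sup>H)\<close> with \<open>Z = T\<^sup>-\<^sup>1 U\<close>.\<close>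

theorem matrix_determinant_lemma:
  fixes X :: "complex^'m^'m" and U :: "complex^'n^'m"
  assumes X: "pos_def_hermitian X"
  shows "det (X + U ** adj U) = det X * det (mat 1 + adj U ** matrix_inv X ** U)"
proof -
  obtain T :: "complex^'m^'m" and p where T: "invertible T" "X = T ** adj T"
    using simultaneous_diagonalization[OF X pos_def_hermitianD[OF X]] by blast
  define T' where "T' = matrix_inv T"
  have T': "T ** T' = mat 1" "T' ** T = mat 1" using matrix_inv_mult[OF T(1)] by (simp_all add: T'_def)
  have aT': "adj T' ** adj T = mat 1" "adj T ** adj T' = mat 1" using T' by (simp_all flip: adj_mult)
  have "X ** (adj T' ** T') = T ** (adj T ** adj T') ** T'" by (simp only: T(2) matrix_mul_assoc)
  then have Xinv: "matrix_inv X = adj T' ** T'" by (intro matrix_inv_eq) (simp add: aT' T')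
  define Z where "Z = T' ** U"
  have "X + U ** adj U = T ** adj T + (T ** T') ** U ** adj U ** (adj T' ** adj T)"
    by (simp add: T(2) T' aT')
  also have "\<dots> = T ** (mat 1 + Z ** adj Z) ** adj T"
    by (simp add: Z_def adj_simps mat_ring)
  finally have "det (X + U ** adj U) = det X * det (mat 1 + Z ** adj Z)"
    by (simp add: T(2) det_mul mult_ac)
  also have "det (mat 1 + Z ** adj Z) = det (mat 1 + adj Z ** Z)" by (rule det_sylvester)
  also have "adj Z ** Z = adj U ** matrix_inv X ** U"
    by (simp add: Z_def Xinv adj_simps matrix_mul_assoc)
  finally show ?thesis .
qed

theorem woodbury:
  fixes X :: "complex^'m^'m" and Z :: "complex^'n^'n" and U :: "complex^'n^'m" and W :: "complex^'m^'n"
  assumes X: "invertible X" and Z: "invertible Z" and Y: "invertible (Z + W ** matrix_inv X ** U)"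
  shows "matrix_inv (X + U ** matrix_inv Z ** W) = matrix_inv X
    - matrix_inv X ** U ** matrix_inv (Z + W ** matrix_inv X ** U) ** W ** matrix_inv X"
proof (rule matrix_inv_eq)
  define X' where "X' = matrix_inv X"
  define Z' where "Z' = matrix_inv Z"
  define Y where "Y = Z + W ** X' ** U"
  define Y' where "Y' = matrix_inv Y"
  have X': "X ** X' = mat 1" and Z': "Z' ** Z = mat 1" and Y': "Y ** Y' = mat 1"
    using matrix_inv_mult X Z \<open>invertible (Z + W ** matrix_inv X ** U)\<close>
    by (auto simp: X'_def Z'_def Y'_def Y_def)
  have WXU: "W ** X' ** U = Y - Z" by (simp add: Y_def)
  have "(X + U ** Z' ** W) ** (X' - X' ** U ** Y' ** W ** X')
    = X ** X' - (X ** X') ** U ** Y' ** W ** X' + U ** Z' ** W ** X'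
      - U ** Z' ** (W ** X' ** U) ** Y' ** W ** X'"
    by (simp add: mat_ring)
  also have "\<dots> = mat 1 - U ** Y' ** W ** X' + U ** Z' ** W ** X'
      - U ** (Z' ** (Y ** Y') - (Z' ** Z) ** Y') ** W ** X'"
    unfolding WXU by (simp add: X' mat_ring)
  also have "\<dots> = mat 1" by (simp add: Y' Z' mat_ring)
  finally show "(X + U ** matrix_inv Z ** W) ** (matrix_inv X - matrix_inv X ** U
      ** matrix_inv (Z + W ** matrix_inv X ** U) ** W ** matrix_inv X) = mat 1"
    by (simp add: X'_def Z'_def Y'_def Y_def)
qed

section \<open>Continuity\<close>

lemma tendsto_matrixI:
  assumes "\<And>i j. ((\<lambda>x. f x $ i $ j) \<longlongrightarrow> l $ i $ j) F"
  shows "(f \<longlongrightarrow> l) F"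
  by (intro vec_tendstoI assms)

lemma tendsto_component:
  "(f \<longlongrightarrow> l) F \<Longrightarrow> ((\<lambda>x. f x $ i $ j) \<longlongrightarrow> l $ i $ j) F"
  by (intro tendsto_vec_nth)

lemma tendsto_matrix_mult [tendsto_intros]:
  fixes f :: "'x \<Rightarrow> complex^'n^'m" and g :: "'x \<Rightarrow> complex^'k^'n"
  assumes "(f \<longlongrightarrow> A) F" "(g \<longlongrightarrow> B) F"
  shows "((\<lambda>x. f x ** g x) \<longlongrightarrow> A ** B) F"
  by (rule tendsto_matrixI)
    (use assms in \<open>simp add: matrix_matrix_mult_def, intro tendsto_intros tendsto_component\<close>)

lemma tendsto_adj [tendsto_intros]:
  "(f \<longlongrightarrow> A) F \<Longrightarrow> ((\<lambda>x. adj (f x)) \<longlongrightarrow> adj A) F"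
  by (rule tendsto_matrixI) (simp add: adj_def, intro tendsto_intros tendsto_component)

lemma tendsto_trace [tendsto_intros]:
  fixes f :: "'x \<Rightarrow> complex^'n^'n"
  shows "(f \<longlongrightarrow> A) F \<Longrightarrow> ((\<lambda>x. trace (f x)) \<longlongrightarrow> trace A) F"
  unfolding trace_def by (intro tendsto_intros tendsto_component)

lemma tendsto_det [tendsto_intros]:
  fixes f :: "'x \<Rightarrow> complex^'n^'n"
  shows "(f \<longlongrightarrow> A) F \<Longrightarrow> ((\<lambda>x. det (f x)) \<longlongrightarrow> det A) F"
  unfolding det_def by (intro tendsto_intros tendsto_component)

text \<open>Cramer's rule makes the entries of the inverse quotients of determinants, whence continuity of
  the inverse.\<close>

lemma matrix_inv_cramer:
  fixes M :: "complex^'n^'n"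
  assumes "det M \<noteq> 0"
  shows "matrix_inv M $ k $ j = det (\<chi> i l. if l = k then mat 1 $ i $ j else M $ i $ l) / det M"
proof -
  have "invertible M" using assms by (simp add: invertible_det_nz)
  then have "M ** matrix_inv M = mat 1" by (rule matrix_inv_mult)
  then have "M *v (\<chi> i. matrix_inv M $ i $ j) = (\<chi> i. mat 1 $ i $ j)"
    by (simp add: vec_eq_iff matrix_matrix_mult_def matrix_vector_mult_def)
  then show ?thesis unfolding cramer[OF assms] by (simp add: vec_eq_iff cong: if_cong)
qed

lemma tendsto_matrix_inv [tendsto_intros]:
  fixes f :: "'x \<Rightarrow> complex^'n^'n"
  assumes f: "(f \<longlongrightarrow> M) F" and M: "invertible M"
  shows "((\<lambda>x. matrix_inv (f x)) \<longlongrightarrow> matrix_inv M) F"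
proof (rule tendsto_matrixI)
  fix k j
  have d: "det M \<noteq> 0" using M by (simp add: invertible_det_nz)
  have ev: "\<forall>\<^sub>F x in F. det (f x) \<noteq> 0"
    by (rule tendsto_imp_eventually_ne[OF tendsto_det[OF f] d])
  have num: "((\<lambda>x. \<chi> i l. if l = k then mat 1 $ i $ j else f x $ i $ l) \<longlongrightarrow>
      (\<chi> i l. if l = k then mat 1 $ i $ j else M $ i $ l)) F"
    by (rule tendsto_matrixI) (simp add: tendsto_component[OF f])
  show "((\<lambda>x. matrix_inv (f x) $ k $ j) \<longlongrightarrow> matrix_inv M $ k $ j) F"
    unfolding matrix_inv_cramer[OF d]
    by (rule Lim_transform_eventually[OF tendsto_divide[OF tendsto_det[OF num] tendsto_det[OF f] d]])
      (use ev in eventually_elim, simp add: matrix_inv_cramer)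
qed

lemma tendsto_logdet [tendsto_intros]:
  fixes f :: "'x \<Rightarrow> complex^'n^'n"
  assumes "(f \<longlongrightarrow> M) F" "pos_def_hermitian M"
  shows "((\<lambda>x. logdet (f x)) \<longlongrightarrow> logdet M) F"
  unfolding logdet_def
  by (intro tendsto_ln tendsto_Re tendsto_det assms) (use pos_def_det(1)[OF assms(2)] in simp)

section \<open>The constraint set\<close>

lemma C1_iff:
  fixes Q :: "complex^'n^'n"
  shows "Q \<in> C1 \<longleftrightarrow> nonneg_hermitian Q \<and> trace Q = of_nat CARD('n)"
  by (auto simp: C1_def divide_eq_eq)

lemma C1_nonzero: "Q \<in> C1 \<Longrightarrow> Q \<noteq> 0"
  by (auto simp: C1_iff trace_0[simplified])

lemma C1_convex:
  assumes "Q \<in> C1" "R \<in> C1" "0 \<le> e" "e \<le> 1"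
  shows "Q + e *\<^sub>R (R - Q) \<in> C1"
proof -
  have eq: "Q + e *\<^sub>R (R - Q) = (1 - e) *\<^sub>R Q + e *\<^sub>R R" by (simp add: algebra_simps)
  have "nonneg_hermitian ((1 - e) *\<^sub>R Q + e *\<^sub>R R)"
    using assms by (intro nonneg_add nonneg_scaleR) (simp_all add: C1_iff)
  moreover have "trace ((1 - e) *\<^sub>R Q + e *\<^sub>R R) = trace Q"
    using assms by (simp add: trace_add trace_scaleR C1_iff flip: scaleR_add_left)
  ultimately show ?thesis unfolding eq using assms by (simp only: C1_iff)
qed

lemma trace_gram: "Re (trace (M ** adj M)) = (norm (M :: complex^'n^'m))\<^sup>2"
  by (simp add: trace_def matrix_matrix_mult_def power2_norm_eq_inner inner_vec_def adj_def
      inner_complex_def)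

text \<open>Square roots of elements of the constraint set lie on a sphere. Extracting a
  convergent subsequence of square roots makes \<open>S\<close> and \<open>Q = S\<^sup>2\<close> converge together.\<close>

lemma norm_msqrt:
  fixes Q :: "complex^'n^'n"
  assumes "Q \<in> C1"
  shows "(norm (msqrt Q))\<^sup>2 = real CARD('n)"
proof -
  have nn: "nonneg_hermitian Q" using assms by (simp add: C1_iff)
  have "msqrt Q ** adj (msqrt Q) = Q"
    using nonneg_hermitianD[OF nonneg_msqrt[OF nn]] msqrt_square[OF nn] by simp
  then show ?thesis using trace_gram[of "msqrt Q"] assms by (simp add: C1_iff)
qed

section \<open>The lifted form of the functional\<close>

text \<open>Throughout, \<open>S\<close> stands for the square root of the input covariance \<open>Q\<close>. In terms of
  \<open>D = I + a \<kappa>t C\<close> and \<open>Z = I + a \<kappa> S Ct S\<close>, the matrices \<open>Y\<close> and \<open>H\<close> are the two Schur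
  complements of the block matrix with rows \<open>(Z, - S F\<^sup>H)\<close> and \<open>(F S, D)\<close>.
  The matrices inverted in the first and second equation for \<open>(\<delta>, \<delta>t)\<close> are \<open>\<sigma>\<^sup>2 H\<close> and
  \<open>\<sigma>\<^sup>2 Y\<close>. The functions \<open>rhs1\<close> and \<open>rhs2\<close> are the right-hand sides of
  these equations; the traces there are real, being traces of products of Hermitian matrices. The
  matrix \<open>lifted\<close> is the matrix \<open>M\<close> of the overview.\<close>

locale rician_channel =
  fixes \<sigma> K :: real
    and A :: "complex^'t^'r" and C :: "complex^'r^'r" and Ct :: "complex^'t^'t"
  assumes sigma: "0 < \<sigma>\<^sup>2" and K_nonneg: "0 \<le> K"
    and C: "pos_def_hermitian C" and Ct: "pos_def_hermitian Ct"
begin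

definition a :: real where "a = 1 / (K + 1)"

definition \<tau> :: real where "\<tau> = real CARD('t) * \<sigma>\<^sup>2"

definition F :: "complex^'t^'r" where "F = sqrt (K / (\<sigma>\<^sup>2 * (K + 1))) *\<^sub>R A"

definition D :: "real \<Rightarrow> complex^'r^'r" where "D kt = mat 1 + (a * kt) *\<^sub>R C"

definition Z :: "complex^'t^'t \<Rightarrow> real \<Rightarrow> complex^'t^'t"
  where "Z S k = mat 1 + (a * k) *\<^sub>R (S ** Ct ** S)"

definition Y :: "complex^'t^'t \<Rightarrow> real \<Rightarrow> real \<Rightarrow> complex^'t^'t"
  where "Y S k kt = Z S k + S ** adj F ** matrix_inv (D kt) ** F ** S"

definition H :: "complex^'t^'t \<Rightarrow> real \<Rightarrow> real \<Rightarrow> complex^'r^'r"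
  where "H S k kt = D kt + F ** S ** matrix_inv (Z S k) ** S ** adj F"

definition rhs1 :: "complex^'t^'t \<Rightarrow> real \<Rightarrow> real \<Rightarrow> real"
  where "rhs1 S k kt = Re (trace (C ** matrix_inv (H S k kt))) / \<tau>"

definition rhs2 :: "complex^'t^'t \<Rightarrow> real \<Rightarrow> real \<Rightarrow> real"
  where "rhs2 S k kt = Re (trace ((S ** Ct ** S) ** matrix_inv (Y S k kt))) / \<tau>"

definition N :: "complex^'t^('t + 'r)" where "N = inl_mat - inr_mat ** F"

definition E0 :: "complex^'t^'t" where "E0 = matrix_inv (a *\<^sub>R Ct)"

definition lifted :: "real \<Rightarrow> real \<Rightarrow> complex^'t^'t \<Rightarrow> complex^('t + 'r)^('t + 'r)"
  where "lifted k kt Q = bdiag ((1 / k) *\<^sub>R E0) (D kt) + N ** Q ** adj N"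

lemma a_pos: "0 < a" using K_nonneg by (simp add: a_def)

lemma tau_pos: "0 < \<tau>" using sigma by (simp add: \<tau>_def)

lemma F_sandwich: "\<sigma>\<^sup>2 *\<^sub>R (F ** X ** adj F) = (K / (K + 1)) *\<^sub>R (A ** X ** adj A)"
  "\<sigma>\<^sup>2 *\<^sub>R (adj F ** W ** F) = (K / (K + 1)) *\<^sub>R (adj A ** W ** A)"
proof -
  have nn: "0 \<le> K / (\<sigma>\<^sup>2 * (K + 1))" using sigma K_nonneg by simp
  have "\<sigma> \<noteq> 0" using sigma by auto
  have "sqrt q * sqrt q = q" if "0 \<le> q" for q using that by simp
  from this[OF nn]
  have e: "\<sigma>\<^sup>2 * (sqrt (K / (\<sigma>\<^sup>2 * (K + 1))) * sqrt (K / (\<sigma>\<^sup>2 * (K + 1)))) = K / (K + 1)"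
    using \<open>\<sigma> \<noteq> 0\<close> by (simp only:) simp
  show "\<sigma>\<^sup>2 *\<^sub>R (F ** X ** adj F) = (K / (K + 1)) *\<^sub>R (A ** X ** adj A)"
    "\<sigma>\<^sup>2 *\<^sub>R (adj F ** W ** F) = (K / (K + 1)) *\<^sub>R (adj A ** W ** A)"
    unfolding F_def adj_scaleR by (simp_all only: scaleR_mult_left scaleR_mult_right scaleR_scaleR e mult.assoc)
qed

lemma pos_def_D: "0 \<le> kt \<Longrightarrow> pos_def_hermitian (D kt)"
  unfolding D_def
  by (intro pos_def_add pos_def_one nonneg_scaleR pos_def_imp_nonneg[OF C]) (simp add: a_pos less_imp_le)

lemma nonneg_S_Ct_S: "nonneg_hermitian S \<Longrightarrow> nonneg_hermitian (S ** Ct ** S)"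
  using nonneg_congruence[OF pos_def_imp_nonneg[OF Ct], of S] by (simp add: nonneg_hermitianD)

lemma pos_def_Z: "nonneg_hermitian S \<Longrightarrow> 0 \<le> k \<Longrightarrow> pos_def_hermitian (Z S k)"
  unfolding Z_def
  by (intro pos_def_add pos_def_one nonneg_scaleR nonneg_S_Ct_S) (simp_all add: a_pos less_imp_le)

lemma H_split:
  assumes "nonneg_hermitian S" "0 \<le> k" "0 \<le> kt"
  obtains W where "nonneg_hermitian W" "H S k kt = 1 *\<^sub>R mat 1 + W"
proof -
  have "nonneg_hermitian ((F ** S) ** matrix_inv (Z S k) ** adj (F ** S))"
    by (intro nonneg_congruence pos_def_imp_nonneg pos_def_inverse pos_def_Z assms)
  then have "nonneg_hermitian (F ** S ** matrix_inv (Z S k) ** S ** adj F)"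
    using nonneg_hermitianD[OF assms(1)] by (simp add: adj_simps matrix_mul_assoc)
  then have "nonneg_hermitian ((a * kt) *\<^sub>R C + F ** S ** matrix_inv (Z S k) ** S ** adj F)"
    by (intro nonneg_add nonneg_scaleR pos_def_imp_nonneg[OF C]) (use assms a_pos in simp_all)
  then show ?thesis by (rule that) (simp add: H_def D_def)
qed

lemma Y_split:
  assumes "nonneg_hermitian S" "0 \<le> k" "0 \<le> kt"
  obtains W where "nonneg_hermitian W" "Y S k kt = 1 *\<^sub>R mat 1 + W"
proof -
  have "nonneg_hermitian ((S ** adj F) ** matrix_inv (D kt) ** adj (S ** adj F))"
    by (intro nonneg_congruence pos_def_imp_nonneg pos_def_inverse pos_def_D assms)
  then have "nonneg_hermitian (S ** adj F ** matrix_inv (D kt) ** F ** S)"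
    using nonneg_hermitianD[OF assms(1)] by (simp add: adj_simps matrix_mul_assoc)
  then have "nonneg_hermitian ((a * k) *\<^sub>R (S ** Ct ** S) + S ** adj F ** matrix_inv (D kt) ** F ** S)"
    by (intro nonneg_add nonneg_scaleR nonneg_S_Ct_S) (use assms a_pos in simp_all)
  then show ?thesis by (rule that) (simp add: Y_def Z_def)
qed

lemma pos_def_Y:
  assumes "nonneg_hermitian S" "0 \<le> k" "0 \<le> kt"
  shows "pos_def_hermitian (Y S k kt)"
  using Y_split[OF assms] pos_def_add[OF pos_def_one] by (metis scaleR_one)

lemma pos_def_H:
  assumes "nonneg_hermitian S" "0 \<le> k" "0 \<le> kt"
  shows "pos_def_hermitian (H S k kt)"
  using H_split[OF assms] pos_def_add[OF pos_def_one] by (metis scaleR_one)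

lemma S_Ct_S_nonzero:
  assumes S: "nonneg_hermitian S" "S \<noteq> 0"
  shows "S ** Ct ** S \<noteq> 0"
proof
  assume *: "S ** Ct ** S = 0"
  have "S *v x = 0" for x
  proof (rule ccontr)
    assume "S *v x \<noteq> 0"
    then have "0 < Re (herm_form Ct (S *v x))" using Ct by (simp add: pos_def_hermitian_def)
    also have "herm_form Ct (S *v x) = herm_form (S ** Ct ** S) x"
      using herm_form_congruence[of S Ct x] nonneg_hermitianD[OF S(1)] by simp
    finally show False by (simp add: * herm_form_def)
  qed
  then show False using S(2) by (simp add: matrix_eq)
qed

lemma rhs1_pos: "nonneg_hermitian S \<Longrightarrow> 0 \<le> k \<Longrightarrow> 0 \<le> kt \<Longrightarrow> 0 < rhs1 S k kt"
  unfolding rhs1_def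
  by (intro divide_pos_pos trace_nonneg_inverse_pos pos_def_imp_nonneg[OF C] pos_def_nonzero[OF C] pos_def_H tau_pos)

lemma rhs2_pos: "nonneg_hermitian S \<Longrightarrow> S \<noteq> 0 \<Longrightarrow> 0 \<le> k \<Longrightarrow> 0 \<le> kt \<Longrightarrow> 0 < rhs2 S k kt"
  unfolding rhs2_def
  by (intro divide_pos_pos trace_nonneg_inverse_pos nonneg_S_Ct_S S_Ct_S_nonzero pos_def_Y tau_pos)

lemma rhs1_le:
  assumes "nonneg_hermitian S" "0 \<le> k" "0 \<le> kt"
  shows "rhs1 S k kt \<le> Re (trace C) / \<tau>"
proof -
  obtain W where "nonneg_hermitian W" "H S k kt = 1 *\<^sub>R mat 1 + W" using H_split[OF assms] .
  with trace_inverse_le[OF pos_def_imp_nonneg[OF C] this(1), of 1]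
  show ?thesis using tau_pos by (simp add: rhs1_def divide_right_mono)
qed

lemma rhs2_le:
  assumes "nonneg_hermitian S" "0 \<le> k" "0 \<le> kt"
  shows "rhs2 S k kt \<le> Re (trace (S ** Ct ** S)) / \<tau>"
proof -
  obtain W where "nonneg_hermitian W" "Y S k kt = 1 *\<^sub>R mat 1 + W" using Y_split[OF assms] .
  with trace_inverse_le[OF nonneg_S_Ct_S[OF assms(1)] this(1), of 1]
  show ?thesis using tau_pos by (simp add: rhs2_def divide_right_mono)
qed

lemma tendsto_rhs:
  assumes "(S \<longlongrightarrow> S0) G" "(k \<longlongrightarrow> k0) G" "(kt \<longlongrightarrow> kt0) G"
    and "nonneg_hermitian S0" "0 \<le> k0" "0 \<le> kt0"
  shows "((\<lambda>x. rhs1 (S x) (k x) (kt x)) \<longlongrightarrow> rhs1 S0 k0 kt0) G"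
    and "((\<lambda>x. rhs2 (S x) (k x) (kt x)) \<longlongrightarrow> rhs2 S0 k0 kt0) G"
proof -
  have D: "((\<lambda>x. D (kt x)) \<longlongrightarrow> D kt0) G"
    unfolding D_def by (intro tendsto_intros assms)
  have Z: "((\<lambda>x. Z (S x) (k x)) \<longlongrightarrow> Z S0 k0) G"
    unfolding Z_def by (intro tendsto_intros assms)
  have "((\<lambda>x. H (S x) (k x) (kt x)) \<longlongrightarrow> H S0 k0 kt0) G"
    unfolding H_def by (intro tendsto_intros assms D Z pos_def_invertible pos_def_Z)
  then show "((\<lambda>x. rhs1 (S x) (k x) (kt x)) \<longlongrightarrow> rhs1 S0 k0 kt0) G"
    unfolding rhs1_def using tau_pos
    by (intro tendsto_intros pos_def_invertible pos_def_H assms) simp_all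
  have "((\<lambda>x. Y (S x) (k x) (kt x)) \<longlongrightarrow> Y S0 k0 kt0) G"
    unfolding Y_def by (intro tendsto_intros assms D Z pos_def_invertible pos_def_D)
  then show "((\<lambda>x. rhs2 (S x) (k x) (kt x)) \<longlongrightarrow> rhs2 S0 k0 kt0) G"
    unfolding rhs2_def using tau_pos
    by (intro tendsto_intros pos_def_invertible pos_def_Y assms) simp_all
qed

text \<open>Pulling \<open>\<sigma>\<^sup>2\<close> out of the inverses identifies the complex equations of the system with the real
  ones used below.\<close>

lemma delta_system_iff:
  assumes Q: "nonneg_hermitian Q" and d: "0 \<le> d" "0 \<le> dt"
  shows "delta_system \<sigma> K A C Ct Q d dt \<longleftrightarrow> d = rhs1 (msqrt Q) d dt \<and> dt = rhs2 (msqrt Q) d dt"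
proof -
  define S where "S = msqrt Q"
  have S: "nonneg_hermitian S" unfolding S_def by (rule nonneg_msqrt[OF Q])
  have s0: "\<sigma>\<^sup>2 \<noteq> 0" using sigma by simp
  have ak: "k / (K + 1) = a * k" for k by (simp add: a_def)
  have aH: "adj (matrix_inv (H S d dt)) = matrix_inv (H S d dt)"
    by (intro pos_def_hermitianD pos_def_inverse pos_def_H S d)
  have aY: "adj (matrix_inv (Y S d dt)) = matrix_inv (Y S d dt)"
    by (intro pos_def_hermitianD pos_def_inverse pos_def_Y S d)
  have "\<sigma>\<^sup>2 *\<^sub>R (mat 1 + (dt / (K + 1)) *\<^sub>R C) + (K / (K + 1)) *\<^sub>R (A ** S
      ** matrix_inv (mat 1 + (d / (K + 1)) *\<^sub>R (S ** Ct ** S)) ** S ** adj A) = \<sigma>\<^sup>2 *\<^sub>R H S d dt"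
    using F_sandwich(1)[of "S ** matrix_inv (Z S d) ** S"]
    by (simp add: H_def D_def Z_def ak scaleR_add_right matrix_mul_assoc)
  then have "trace (C ** matrix_inv (\<sigma>\<^sup>2 *\<^sub>R (mat 1 + (dt / (K + 1)) *\<^sub>R C)
        + (K / (K + 1)) *\<^sub>R (A ** S ** matrix_inv (mat 1 + (d / (K + 1)) *\<^sub>R (S ** Ct ** S))
            ** S ** adj A))) = (1 / \<sigma>\<^sup>2) *\<^sub>R trace (C ** matrix_inv (H S d dt))"
    using s0 by (simp add: matrix_inv_scaleR pos_def_invertible pos_def_H S d scaleR_mult_right trace_scaleR)
  then have 1: "1 / of_nat CARD('t) * trace (C ** matrix_inv (\<sigma>\<^sup>2 *\<^sub>R (mat 1 + (dt / (K + 1)) *\<^sub>R C)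
        + (K / (K + 1)) *\<^sub>R (A ** S ** matrix_inv (mat 1 + (d / (K + 1)) *\<^sub>R (S ** Ct ** S))
            ** S ** adj A))) = complex_of_real (rhs1 S d dt)"
    using trace_hermitian_real[OF pos_def_hermitianD[OF C] aH]
    by (simp add: rhs1_def \<tau>_def scaleR_conv_of_real)
  have "\<sigma>\<^sup>2 *\<^sub>R (mat 1 + (d / (K + 1)) *\<^sub>R (S ** Ct ** S)) + (K / (K + 1)) *\<^sub>R (S ** adj A
      ** matrix_inv (mat 1 + (dt / (K + 1)) *\<^sub>R C) ** A ** S) = \<sigma>\<^sup>2 *\<^sub>R Y S d dt"
  proof -
    have "S ** (\<sigma>\<^sup>2 *\<^sub>R (adj F ** matrix_inv (D dt) ** F)) ** S
      = S ** ((K / (K + 1)) *\<^sub>R (adj A ** matrix_inv (D dt) ** A)) ** S"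
      by (simp only: F_sandwich(2))
    then show ?thesis by (simp add: Y_def D_def Z_def ak scaleR_add_right mat_ring)
  qed
  then have "trace ((S ** Ct ** S) ** matrix_inv (\<sigma>\<^sup>2 *\<^sub>R (mat 1
        + (d / (K + 1)) *\<^sub>R (S ** Ct ** S)) + (K / (K + 1)) *\<^sub>R (S ** adj A
            ** matrix_inv (mat 1 + (dt / (K + 1)) *\<^sub>R C) ** A ** S)))
        = (1 / \<sigma>\<^sup>2) *\<^sub>R trace ((S ** Ct ** S) ** matrix_inv (Y S d dt))"
    using s0 by (simp add: matrix_inv_scaleR pos_def_invertible pos_def_Y S d scaleR_mult_right trace_scaleR)
  then have 2: "1 / of_nat CARD('t) * trace ((S ** Ct ** S) ** matrix_inv (\<sigma>\<^sup>2 *\<^sub>R (mat 1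
        + (d / (K + 1)) *\<^sub>R (S ** Ct ** S)) + (K / (K + 1)) *\<^sub>R (S ** adj A
            ** matrix_inv (mat 1 + (dt / (K + 1)) *\<^sub>R C) ** A ** S))) = complex_of_real (rhs2 S d dt)"
    using trace_hermitian_real[OF nonneg_hermitianD[OF nonneg_S_Ct_S[OF S]] aY]
    by (simp add: rhs2_def \<tau>_def scaleR_conv_of_real)
  show ?thesis
    unfolding delta_system_def S_def[symmetric] 1 2 of_real_eq_iff ..
qed

lemma pos_def_E0: "pos_def_hermitian E0"
  unfolding E0_def by (intro pos_def_inverse pos_def_scaleR Ct a_pos)

lemma base_inverse:
  assumes "0 < k" "0 \<le> kt"
  shows "matrix_inv (bdiag ((1 / k) *\<^sub>R E0) (D kt)) = bdiag ((a * k) *\<^sub>R Ct) (matrix_inv (D kt))"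
proof (rule matrix_inv_eq)
  have "E0 ** (a *\<^sub>R Ct) = mat 1" unfolding E0_def
    by (intro matrix_inv_mult pos_def_invertible pos_def_scaleR Ct a_pos)
  moreover have "D kt ** matrix_inv (D kt) = mat 1"
    by (intro matrix_inv_mult pos_def_invertible pos_def_D assms)
  ultimately show "bdiag ((1 / k) *\<^sub>R E0) (D kt) ** bdiag ((a * k) *\<^sub>R Ct) (matrix_inv (D kt)) = mat 1"
    using assms by (simp add: bdiag_mult mat_ring)
qed

lemma N_sandwich: "adj N ** bdiag X W ** N = X + adj F ** W ** F"
  by (simp add: N_def bdiag_def adj_simps mat_ring)

lemma pos_def_base: "0 < k \<Longrightarrow> 0 \<le> kt \<Longrightarrow> pos_def_hermitian (bdiag ((1 / k) *\<^sub>R E0) (D kt))"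
  by (intro pos_def_bdiag pos_def_scaleR pos_def_E0 pos_def_D) simp_all

lemma pos_def_lifted:
  "0 < k \<Longrightarrow> 0 \<le> kt \<Longrightarrow> nonneg_hermitian Q \<Longrightarrow> pos_def_hermitian (lifted k kt Q)"
  unfolding lifted_def by (intro pos_def_add pos_def_base nonneg_congruence)

text \<open>This is the form in which \<open>Y\<close> appears when \<open>N Q N\<^sup>H = (N S) (N S)\<^sup>H\<close> is treated as an update of
  the block diagonal part of \<open>lifted\<close>.\<close>

lemma Y_base:
  assumes "0 < k" "0 \<le> kt" "nonneg_hermitian S"
  shows "Y S k kt = mat 1 + adj (N ** S) ** matrix_inv (bdiag ((1 / k) *\<^sub>R E0) (D kt)) ** (N ** S)"
proof -
  have "adj (N ** S) ** matrix_inv (bdiag ((1 / k) *\<^sub>R E0) (D kt)) ** (N ** S)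
    = S ** (adj N ** bdiag ((a * k) *\<^sub>R Ct) (matrix_inv (D kt)) ** N) ** S"
    using assms by (simp add: base_inverse adj_simps nonneg_hermitianD matrix_mul_assoc)
  then show ?thesis by (simp add: N_sandwich Y_def Z_def mat_ring)
qed

lemma lifted_gram:
  assumes "nonneg_hermitian S"
  shows "lifted k kt (S ** S) = bdiag ((1 / k) *\<^sub>R E0) (D kt) + (N ** S) ** adj (N ** S)"
  using nonneg_hermitianD[OF assms] by (simp add: lifted_def adj_simps matrix_mul_assoc)

text \<open>The matrix determinant lemma gives \<open>ln det M = ln det diag((a \<kappa> Ct)\<^sup>-\<^sup>1, D) + ln det Y\<close>. The
  block diagonal part contributes \<open>ln det D\<close>, which belongs to \<open>V\<close>, and \<open>- ln det (a \<kappa> Ct)\<close>, which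
  produces the terms \<open>t ln \<kappa>\<close> and \<open>ln det (a Ct)\<close>.\<close>

lemma V_lifted:
  assumes k: "0 < k" "0 \<le> kt" and Q: "nonneg_hermitian Q"
  shows "V \<sigma> K A C Ct k kt Q = real CARD('t) * ln k + logdet (a *\<^sub>R Ct) + logdet (lifted k kt Q)
    - a * \<tau> * k * kt"
proof -
  define S where "S = msqrt Q"
  have S: "nonneg_hermitian S" "S ** S = Q"
    unfolding S_def by (rule nonneg_msqrt[OF Q], rule msqrt_square[OF Q])
  have ak: "x / (K + 1) = a * x" for x by (simp add: a_def)
  have inner: "mat 1 + (k / (K + 1)) *\<^sub>R (S ** Ct ** S) + (K / (\<sigma>\<^sup>2 * (K + 1))) *\<^sub>R (S ** adj A
          ** matrix_inv (mat 1 + (kt / (K + 1)) *\<^sub>R C) ** A ** S) = Y S k kt"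
  proof -
    have s0: "\<sigma>\<^sup>2 \<noteq> 0" using sigma by simp
    have "adj F ** matrix_inv (D kt) ** F
      = (1 / \<sigma>\<^sup>2) *\<^sub>R (\<sigma>\<^sup>2 *\<^sub>R (adj F ** matrix_inv (D kt) ** F))" using s0 by simp
    also have "\<dots> = (K / (\<sigma>\<^sup>2 * (K + 1))) *\<^sub>R (adj A ** matrix_inv (D kt) ** A)"
      unfolding F_sandwich(2) by simp
    finally have "S ** (adj F ** matrix_inv (D kt) ** F) ** S
      = S ** ((K / (\<sigma>\<^sup>2 * (K + 1))) *\<^sub>R (adj A ** matrix_inv (D kt) ** A)) ** S" by simp
    then show ?thesis by (simp add: Y_def D_def Z_def ak mat_ring)
  qed
  have PD: "pos_def_hermitian (D kt)" "pos_def_hermitian (Y S k kt)"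
    "pos_def_hermitian (bdiag ((1 / k) *\<^sub>R E0) (D kt))" "pos_def_hermitian (a *\<^sub>R Ct)"
    using k S by (simp_all add: pos_def_D pos_def_Y pos_def_base pos_def_scaleR Ct a_pos)
  have "logdet (lifted k kt Q) = logdet (bdiag ((1 / k) *\<^sub>R E0) (D kt)) + logdet (Y S k kt)"
  proof (rule logdet_mult[OF PD(3,2)])
    show "det (lifted k kt Q) = det (bdiag ((1 / k) *\<^sub>R E0) (D kt)) * det (Y S k kt)"
      using lifted_gram[OF S(1), of k kt] matrix_determinant_lemma[OF PD(3), of "N ** S"]
      by (simp add: S(2) Y_base[OF k S(1)])
  qed
  moreover have "logdet (bdiag ((1 / k) *\<^sub>R E0) (D kt)) = logdet ((1 / k) *\<^sub>R E0) + logdet (D kt)"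
  proof (rule logdet_mult)
    show E: "pos_def_hermitian ((1 / k) *\<^sub>R E0)" using k by (simp add: pos_def_scaleR pos_def_E0)
    show "pos_def_hermitian (D kt)" by (rule PD(1))
    show "det (bdiag ((1 / k) *\<^sub>R E0) (D kt)) = det ((1 / k) *\<^sub>R E0) * det (D kt)"
      by (intro det_bdiag pos_def_hermitianD E PD(1))
  qed
  moreover have "logdet ((1 / k) *\<^sub>R E0) = - real CARD('t) * ln k + logdet E0"
    using k by (simp add: logdet_scaleR pos_def_E0 ln_div)
  moreover have "0 = logdet (a *\<^sub>R Ct) + logdet E0"
  proof -
    have "det (mat 1 :: complex^'t^'t) = det (a *\<^sub>R Ct) * det E0"
      using matrix_inv_mult(1)[OF pos_def_invertible[OF PD(4)]] by (simp only: E0_def flip: det_mul)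
    then have "logdet (mat 1 :: complex^'t^'t) = logdet (a *\<^sub>R Ct) + logdet E0"
      by (rule logdet_mult[OF PD(4) pos_def_E0])
    then show ?thesis by (simp add: logdet_def)
  qed
  moreover have "V \<sigma> K A C Ct k kt Q = logdet (Y S k kt) + logdet (D kt) - a * \<tau> * k * kt"
    unfolding V_def S_def[symmetric] inner logdet_def by (simp add: ak D_def \<tau>_def)
  ultimately show ?thesis by simp
qed

lemma lifted_inverse:
  assumes k: "0 < k" "0 \<le> kt" and S: "nonneg_hermitian S"
  defines "B \<equiv> bdiag ((a * k) *\<^sub>R Ct) (matrix_inv (D kt))"
  shows "matrix_inv (lifted k kt (S ** S)) = B - B ** N ** S ** matrix_inv (Y S k kt) ** S ** adj N ** B"
proof -
  have "matrix_inv (bdiag ((1 / k) *\<^sub>R E0) (D kt) + (N ** S) ** matrix_inv (mat 1) ** adj (N ** S))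
    = B - B ** (N ** S) ** matrix_inv (Y S k kt) ** adj (N ** S) ** B"
    unfolding Y_base[OF k S] B_def base_inverse[OF k, symmetric]
  proof (rule woodbury)
    show "invertible (bdiag ((1 / k) *\<^sub>R E0) (D kt))" by (intro pos_def_invertible pos_def_base k)
    show "invertible (mat 1 :: complex^'t^'t)" by (intro pos_def_invertible pos_def_one)
    show "invertible (mat 1 + adj (N ** S) ** matrix_inv (bdiag ((1 / k) *\<^sub>R E0) (D kt)) ** (N ** S))"
      unfolding Y_base[OF k S, symmetric] by (intro pos_def_invertible pos_def_Y S) (use k in simp_all)
  qed
  moreover have "matrix_inv (mat 1 :: complex^'t^'t) = mat 1" by (rule matrix_inv_eq) simp
  ultimately show ?thesis
    by (simp add: lifted_gram[OF S] adj_simps nonneg_hermitianD[OF S] matrix_mul_assoc)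
qed

text \<open>The first equation of the system in lifted form: the lower right block of \<open>M\<^sup>-\<^sup>1\<close> is
  \<open>H\<^sup>-\<^sup>1\<close>. The inverse of \<open>M\<close> and the inverse of \<open>H\<close> are both expanded by Woodbury's
  formula, and the two expansions agree after cyclic permutation under the trace.\<close>

lemma trace_lifted_C:
  assumes k: "0 < k" "0 \<le> kt" and S: "nonneg_hermitian S"
  shows "Re (trace (bdiag 0 C ** matrix_inv (lifted k kt (S ** S)))) = \<tau> * rhs1 S k kt"
proof -
  define D' where "D' = matrix_inv (D kt)"
  define Y' where "Y' = matrix_inv (Y S k kt)"
  define B where "B = bdiag ((a * k) *\<^sub>R Ct) D'"
  have "bdiag 0 C ** matrix_inv (lifted k kt (S ** S))
    = bdiag 0 C ** B - (bdiag 0 C ** B ** N ** S ** Y' ** S ** adj N) ** B"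
    unfolding lifted_inverse[OF assms] B_def D'_def Y'_def by (simp add: mat_ring)
  moreover have "bdiag 0 C ** B = bdiag 0 (C ** D')" by (simp add: B_def bdiag_mult)
  ultimately have "trace (bdiag 0 C ** matrix_inv (lifted k kt (S ** S)))
    = trace (C ** D') - trace ((bdiag 0 (C ** D') ** N ** S ** Y' ** S ** adj N) ** B)"
    by (simp add: trace_sub trace_bdiag trace_0[simplified])
  also have "trace ((bdiag 0 (C ** D') ** N ** S ** Y' ** S ** adj N) ** B)
    = trace (B ** (bdiag 0 (C ** D') ** N ** S ** Y' ** S ** adj N))" by (rule trace_mul_sym)
  also have "\<dots> = trace ((B ** bdiag 0 (C ** D') ** N ** S ** Y') ** (S ** adj N))"
    by (simp only: matrix_mul_assoc)
  also have "\<dots> = trace ((S ** adj N) ** (B ** bdiag 0 (C ** D') ** N ** S ** Y'))" by (rule trace_mul_sym)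
  also have "(S ** adj N) ** (B ** bdiag 0 (C ** D') ** N ** S ** Y')
    = S ** (adj N ** bdiag 0 (D' ** (C ** D')) ** N) ** S ** Y'"
    by (simp add: B_def bdiag_mult flip: matrix_mul_assoc) 
  also have "\<dots> = (S ** adj F ** D') ** (C ** D' ** F ** S ** Y')"
    by (simp add: N_sandwich matrix_mul_assoc)
  also have "trace \<dots> = trace ((C ** D' ** F ** S ** Y') ** (S ** adj F ** D'))" by (rule trace_mul_sym)
  finally have "trace (bdiag 0 C ** matrix_inv (lifted k kt (S ** S)))
    = trace (C ** (D' - D' ** (F ** S) ** Y' ** (S ** adj F) ** D'))"
    by (simp add: trace_sub mat_ring)
  moreover have "matrix_inv (D kt + (F ** S) ** matrix_inv (Z S k) ** (S ** adj F))
    = D' - D' ** (F ** S) ** matrix_inv (Z S k + (S ** adj F) ** D' ** (F ** S)) ** (S ** adj F) ** D'"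
    unfolding D'_def
  proof (rule woodbury)
    show "invertible (D kt)" by (intro pos_def_invertible pos_def_D k)
    show "invertible (Z S k)" by (intro pos_def_invertible pos_def_Z S) (use k in simp)
    have "invertible (Y S k kt)" by (intro pos_def_invertible pos_def_Y S) (use k in simp_all)
    then show "invertible (Z S k + (S ** adj F) ** matrix_inv (D kt) ** (F ** S))"
      by (simp add: Y_def matrix_mul_assoc)
  qed
  then have "matrix_inv (H S k kt) = D' - D' ** (F ** S) ** Y' ** (S ** adj F) ** D'"
    by (simp add: H_def Y_def Y'_def D'_def matrix_mul_assoc)
  ultimately show ?thesis using tau_pos by (simp add: rhs1_def)
qed

text \<open>The second equation of the system in lifted form. The block diagonal part of
  Woodbury's expansion contributes the trace of an identity matrix; the correction, permuted
  cyclically, is \<open>a \<kappa>\<close> times the trace in that equation.\<close>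

lemma trace_lifted_E0:
  assumes k: "0 < k" "0 \<le> kt" and S: "nonneg_hermitian S"
  shows "Re (trace (bdiag ((1 / k) *\<^sub>R E0) 0 ** matrix_inv (lifted k kt (S ** S))))
    = real CARD('t) - a * k * \<tau> * rhs2 S k kt"
proof -
  define D' where "D' = matrix_inv (D kt)"
  define Y' where "Y' = matrix_inv (Y S k kt)"
  define B where "B = bdiag ((a * k) *\<^sub>R Ct) D'"
  have E: "E0 ** (a *\<^sub>R Ct) = mat 1" unfolding E0_def
    by (intro matrix_inv_mult pos_def_invertible pos_def_scaleR Ct a_pos)
  have "bdiag ((1 / k) *\<^sub>R E0) 0 ** matrix_inv (lifted k kt (S ** S))
    = bdiag ((1 / k) *\<^sub>R E0) 0 ** B - (bdiag ((1 / k) *\<^sub>R E0) 0 ** B ** N ** S ** Y' ** S ** adj N) ** B"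
    unfolding lifted_inverse[OF assms] B_def D'_def Y'_def by (simp add: mat_ring)
  moreover have "bdiag ((1 / k) *\<^sub>R E0) 0 ** B = bdiag (mat 1) 0"
    using k E by (simp add: B_def bdiag_mult mat_ring)
  ultimately have "trace (bdiag ((1 / k) *\<^sub>R E0) 0 ** matrix_inv (lifted k kt (S ** S)))
    = of_nat CARD('t) - trace ((bdiag (mat 1) 0 ** N ** S ** Y' ** S ** adj N) ** B)"
    by (simp add: trace_sub trace_bdiag trace_0[simplified] trace_I)
  also have "trace ((bdiag (mat 1) 0 ** N ** S ** Y' ** S ** adj N) ** B)
    = trace (B ** (bdiag (mat 1) 0 ** N ** S ** Y' ** S ** adj N))" by (rule trace_mul_sym)
  also have "\<dots> = trace ((B ** bdiag (mat 1) 0 ** N ** S ** Y') ** (S ** adj N))"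
    by (simp only: matrix_mul_assoc)
  also have "\<dots> = trace ((S ** adj N) ** (B ** bdiag (mat 1) 0 ** N ** S ** Y'))" by (rule trace_mul_sym)
  also have "(S ** adj N) ** (B ** bdiag (mat 1) 0 ** N ** S ** Y')
    = S ** (adj N ** (B ** bdiag (mat 1) 0) ** N) ** S ** Y'" by (simp only: matrix_mul_assoc)
  also have "\<dots> = (a * k) *\<^sub>R ((S ** Ct ** S) ** Y')"
    by (simp add: B_def bdiag_mult N_sandwich mat_ring)
  finally show ?thesis using tau_pos by (simp add: rhs2_def Y'_def trace_scaleR)
qed

section \<open>The saddle point\<close>

definition sol :: "complex^'t^'t \<Rightarrow> real \<Rightarrow> real \<Rightarrow> bool"
  where "sol Q k kt \<longleftrightarrow> 0 < k \<and> 0 < kt \<and> k = rhs1 (msqrt Q) k kt \<and> kt = rhs2 (msqrt Q) k kt"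

text \<open>For fixed \<open>x = \<kappa> \<kappa>t\<close> the lifted matrix is \<open>P + z R\<close> with \<open>z = 1 / \<kappa>\<close>, and \<open>V\<close> is
  \<open>- t ln z + ln det (P + z R)\<close> up to a constant. The two equations of the system combine to
  \<open>z tr (R M\<^sup>-\<^sup>1) = t\<close>, which says that the derivative with respect to \<open>ln z\<close> vanishes; by convexity
  this is the minimum. The lower right block of \<open>P\<close> is at least \<open>I\<close>, so \<open>P \<noteq> 0\<close> and the minimum is
  strict.\<close>

theorem V_minimal_in_kappa:
  assumes Q: "nonneg_hermitian Q" and sol: "sol Q k kt" and k': "0 < k'"
  shows "V \<sigma> K A C Ct k kt Q \<le> V \<sigma> K A C Ct k' (k * kt / k') Q"
    and "k' \<noteq> k \<Longrightarrow> V \<sigma> K A C Ct k kt Q < V \<sigma> K A C Ct k' (k * kt / k') Q"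
proof -
  define S where "S = msqrt Q"
  have S: "nonneg_hermitian S" "S ** S = Q"
    unfolding S_def by (rule nonneg_msqrt[OF Q], rule msqrt_square[OF Q])
  have k: "0 < k" "0 < kt" and eq: "rhs1 S k kt = k" "rhs2 S k kt = kt"
    using sol by (simp_all add: sol_def S_def)
  define P where "P = bdiag 0 (mat 1) + N ** Q ** adj N"
  define R where "R = bdiag E0 ((a * (k * kt)) *\<^sub>R C)"
  have nP: "nonneg_hermitian P" unfolding P_def
    by (intro nonneg_add nonneg_bdiag nonneg_zero pos_def_imp_nonneg[OF pos_def_one] nonneg_congruence Q)
  have pR: "pos_def_hermitian R" unfolding R_def
    using k a_pos by (intro pos_def_bdiag pos_def_E0 pos_def_scaleR C) simp
  have P0: "P \<noteq> 0"
  proof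
    assume "P = 0"
    then have "adj inr_mat ** P ** inr_mat = 0" by simp
    then have "mat 1 + F ** Q ** adj F = 0"
      by (simp add: P_def N_def bdiag_def adj_simps mat_ring)
    moreover have "mat 1 + F ** Q ** adj F \<noteq> 0"
      by (intro pos_def_nonzero pos_def_add pos_def_one nonneg_congruence Q)
    ultimately show False by contradiction
  qed
  have lift: "lifted l (k * kt / l) Q = P + (1 / l) *\<^sub>R R" if "0 < l" for l
  proof -
    have "bdiag ((1 / l) *\<^sub>R E0) (D (k * kt / l)) = bdiag 0 (mat 1) + (1 / l) *\<^sub>R R"
      by (simp add: R_def D_def bdiag_linear)
    then show ?thesis by (simp add: lifted_def P_def)
  qed
  have lk: "lifted k kt Q = P + (1 / k) *\<^sub>R R" using lift[OF k(1)] k by simp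
  have "(1 / k) *\<^sub>R R = bdiag ((1 / k) *\<^sub>R E0) 0 + (a * kt) *\<^sub>R bdiag 0 C"
    using k by (simp add: R_def bdiag_linear)
  then have "((1 / k) *\<^sub>R R) ** matrix_inv (lifted k kt Q) = bdiag ((1 / k) *\<^sub>R E0) 0 ** matrix_inv (lifted k kt Q)
    + (a * kt) *\<^sub>R (bdiag 0 C ** matrix_inv (lifted k kt Q))" by (simp add: mat_ring)
  from arg_cong[OF this, of trace]
  have "(1 / k) *\<^sub>R trace (R ** matrix_inv (lifted k kt Q)) = trace (bdiag ((1 / k) *\<^sub>R E0) 0 ** matrix_inv (lifted k kt Q))
    + (a * kt) *\<^sub>R trace (bdiag 0 C ** matrix_inv (lifted k kt Q))"
    by (simp only: scaleR_mult_left trace_add trace_scaleR)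
  from arg_cong[OF this, of Re]
  have tr: "1 / k * Re (trace (R ** matrix_inv (lifted k kt Q))) = real CARD('t)"
    using trace_lifted_E0[OF k(1) less_imp_le[OF k(2)] S(1)] trace_lifted_C[OF k(1) less_imp_le[OF k(2)] S(1)]
    by (simp add: S(2) eq)
  have quot: "(1 / k') / (1 / k) = k / k'" by simp
  have pos: "0 < 1 / k" "0 < 1 / k'" using k k' by simp_all
  note convex = logdet_log_convex[OF nP pR pos, folded lk lift[OF k'], unfolded tr quot]
  have V1: "V \<sigma> K A C Ct k kt Q = real CARD('t) * ln k + logdet (a *\<^sub>R Ct) + logdet (lifted k kt Q)
    - a * \<tau> * k * kt" by (rule V_lifted) (use k Q in simp_all)
  have V2: "V \<sigma> K A C Ct k' (k * kt / k') Q = real CARD('t) * ln k' + logdet (a *\<^sub>R Ct)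
    + logdet (lifted k' (k * kt / k') Q) - a * \<tau> * k * kt"
    using V_lifted[of k' "k * kt / k'" Q] k k' Q by simp
  have ln: "real CARD('t) * ln (k / k') = real CARD('t) * ln k - real CARD('t) * ln k'"
    using k k' by (simp add: ln_div algebra_simps)
  show "V \<sigma> K A C Ct k kt Q \<le> V \<sigma> K A C Ct k' (k * kt / k') Q"
    using convex(1) unfolding V1 V2 ln by linarith
  show "V \<sigma> K A C Ct k kt Q < V \<sigma> K A C Ct k' (k * kt / k') Q" if "k' \<noteq> k"
    using convex(2)[OF P0] that k k' unfolding V1 V2 ln by simp
qed

lemma lifted_diff:
  "lifted k kt' R - lifted k kt Q = N ** (R - Q) ** adj N + (a * (kt' - kt)) *\<^sub>R bdiag 0 C"
proof -
  have "D kt' - D kt = (a * (kt' - kt)) *\<^sub>R C" by (simp add: D_def algebra_simps)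
  then have "bdiag ((1 / k) *\<^sub>R E0) (D kt') - bdiag ((1 / k) *\<^sub>R E0) (D kt) = (a * (kt' - kt)) *\<^sub>R bdiag 0 C"
    by (simp add: bdiag_linear)
  then show ?thesis by (simp add: lifted_def mat_ring algebra_simps)
qed

text \<open>For fixed \<open>\<kappa>\<close> the lifted matrix is affine in \<open>(Q, \<kappa>t)\<close>, so the tangent inequality of
  \<open>ln det\<close> is one for \<open>V\<close>. Equality forces equal lifted matrices, and the two diagonal blocks
  then give \<open>R = Q\<close> and equal \<open>\<kappa>t\<close>. The last factor vanishes at solutions of the system
  (\<open>sol_trace\<close>).\<close>

theorem V_tangent:
  assumes k: "0 < k" "0 \<le> kt" "0 \<le> kt'" and Q: "nonneg_hermitian Q" and R: "nonneg_hermitian R"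
  defines "T \<equiv> V \<sigma> K A C Ct k kt Q
    + Re (trace ((N ** (R - Q) ** adj N) ** matrix_inv (lifted k kt Q)))
    + a * (kt' - kt) * (Re (trace (bdiag 0 C ** matrix_inv (lifted k kt Q))) - \<tau> * k)"
  shows "V \<sigma> K A C Ct k kt' R \<le> T" and "V \<sigma> K A C Ct k kt' R = T \<Longrightarrow> kt' = kt \<and> R = Q"
proof -
  note pd = pos_def_lifted[OF k(1) k(3) R] pos_def_lifted[OF k(1) k(2) Q]
  have tr: "Re (trace ((lifted k kt' R - lifted k kt Q) ** matrix_inv (lifted k kt Q)))
    = Re (trace ((N ** (R - Q) ** adj N) ** matrix_inv (lifted k kt Q)))
      + a * (kt' - kt) * Re (trace (bdiag 0 C ** matrix_inv (lifted k kt Q)))"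
    unfolding lifted_diff by (simp only: matrix_add_rdistrib scaleR_mult_left trace_add trace_scaleR) simp
  note tangent = logdet_tangent[OF pd, unfolded tr]
  show "V \<sigma> K A C Ct k kt' R \<le> T"
    unfolding T_def V_lifted[OF k(1,3) R] V_lifted[OF k(1,2) Q]
    using tangent(1) by (simp add: algebra_simps)
  assume "V \<sigma> K A C Ct k kt' R = T"
  then have "lifted k kt' R = lifted k kt Q"
    unfolding T_def V_lifted[OF k(1,3) R] V_lifted[OF k(1,2) Q]
    by (intro tangent(2)) (simp add: algebra_simps)
  then have z: "N ** (R - Q) ** adj N + (a * (kt' - kt)) *\<^sub>R bdiag 0 C = 0"
    by (simp flip: lifted_diff[of k])
  then have "adj inl_mat ** (N ** (R - Q) ** adj N + (a * (kt' - kt)) *\<^sub>R bdiag 0 C) ** inl_mat = 0" by simp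
  then have RQ: "R = Q" by (simp add: N_def bdiag_def adj_simps mat_ring)
  from z have "adj inr_mat ** (N ** (R - Q) ** adj N + (a * (kt' - kt)) *\<^sub>R bdiag 0 C) ** inr_mat = 0" by simp
  then have "(a * (kt' - kt)) *\<^sub>R C = 0" by (simp add: RQ bdiag_def mat_ring)
  then show "kt' = kt \<and> R = Q" using RQ a_pos pos_def_nonzero[OF C] by simp
qed

lemma sol_trace:
  assumes "nonneg_hermitian Q" "sol Q k kt"
  shows "Re (trace (bdiag 0 C ** matrix_inv (lifted k kt Q))) = \<tau> * k"
  using trace_lifted_C[of k kt "msqrt Q"] assms nonneg_msqrt[OF assms(1)] msqrt_square[OF assms(1)]
  by (simp add: sol_def)

lemma V_maximal_in_kappa_tilde:
  assumes Q: "nonneg_hermitian Q" and sol: "sol Q k kt" and kt': "0 \<le> kt'"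
  shows "V \<sigma> K A C Ct k kt' Q \<le> V \<sigma> K A C Ct k kt Q"
    and "V \<sigma> K A C Ct k kt' Q = V \<sigma> K A C Ct k kt Q \<Longrightarrow> kt' = kt"
proof -
  have k: "0 < k" "0 \<le> kt" using sol by (simp_all add: sol_def)
  note T = V_tangent[OF k kt' Q Q, unfolded sol_trace[OF Q sol], simplified trace_0[simplified]]
  show "V \<sigma> K A C Ct k kt' Q \<le> V \<sigma> K A C Ct k kt Q"
    and "V \<sigma> K A C Ct k kt' Q = V \<sigma> K A C Ct k kt Q \<Longrightarrow> kt' = kt"
    using T by (simp_all add: trace_0[simplified])
qed

text \<open>Passing from either solution to the other by a \<open>\<kappa>\<close>-step along \<open>\<kappa> \<kappa>t = const\<close> followed by a
  \<open>\<kappa>t\<close>-step does not decrease \<open>V\<close>. Going around the cycle, all inequalities are equalities, and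
  strictness identifies the solutions.\<close>

lemma sol_unique:
  assumes Q: "nonneg_hermitian Q" and s1: "sol Q k1 kt1" and s2: "sol Q k2 kt2"
  shows "k1 = k2 \<and> kt1 = kt2"
proof -
  let ?V = "\<lambda>k kt. V \<sigma> K A C Ct k kt Q"
  have pos: "0 < k1" "0 < kt1" "0 < k2" "0 < kt2" using s1 s2 by (simp_all add: sol_def)
  have "?V k1 kt1 \<le> ?V k2 (k1 * kt1 / k2)" by (rule V_minimal_in_kappa[OF Q s1 pos(3)])
  moreover have "?V k2 (k1 * kt1 / k2) \<le> ?V k2 kt2"
    by (rule V_maximal_in_kappa_tilde(1)[OF Q s2]) (use pos in simp)
  moreover have "?V k2 kt2 \<le> ?V k1 (k2 * kt2 / k1)" by (rule V_minimal_in_kappa[OF Q s2 pos(1)])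
  moreover have "?V k1 (k2 * kt2 / k1) \<le> ?V k1 kt1"
    by (rule V_maximal_in_kappa_tilde(1)[OF Q s1]) (use pos in simp)
  ultimately have eq: "?V k1 kt1 = ?V k2 (k1 * kt1 / k2)" "?V k2 (k1 * kt1 / k2) = ?V k2 kt2" by linarith+
  have "k2 = k1"
  proof (rule ccontr)
    assume "k2 \<noteq> k1"
    from V_minimal_in_kappa(2)[OF Q s1 pos(3) this] show False using eq by simp
  qed
  moreover have "k1 * kt1 / k2 = kt2"
    by (rule V_maximal_in_kappa_tilde(2)[OF Q s2 _ eq(2)]) (use pos in simp)
  ultimately show ?thesis using pos by simp
qed

text \<open>Both right-hand sides are continuous, positive, and bounded by the values in which the matrix
  to be inverted is replaced by \<open>I\<close>, so they map a rectangle into itself.\<close>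

lemma fixed_point_exists:
  assumes S: "nonneg_hermitian S" "S \<noteq> 0"
  obtains k kt where "0 < k" "0 < kt" "k = rhs1 S k kt" "kt = rhs2 S k kt"
proof -
  define B :: "(real \<times> real) set"
    where "B = {0..Re (trace C) / \<tau>} \<times> {0..Re (trace (S ** Ct ** S)) / \<tau>}"
  define f where "f p = (rhs1 S (fst p) (snd p), rhs2 S (fst p) (snd p))" for p
  have f: "f p \<in> B \<and> 0 < fst (f p) \<and> 0 < snd (f p)" if "0 \<le> fst p" "0 \<le> snd p" for p
    using rhs1_pos[OF S(1) that] rhs2_pos[OF S that] rhs1_le[OF S(1) that] rhs2_le[OF S(1) that]
    by (simp add: B_def f_def)
  have "compact B" "convex B" unfolding B_def by (intro compact_Times convex_Times; simp)+
  moreover have "B \<noteq> {}" using f[of "(0, 0)"] by auto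
  moreover have "continuous_on B f"
    unfolding continuous_on_def
  proof
    fix p assume "p \<in> B"
    then have p: "0 \<le> fst p" "0 \<le> snd p" by (auto simp: B_def)
    show "(f \<longlongrightarrow> f p) (at p within B)"
      unfolding f_def by (intro tendsto_Pair tendsto_rhs tendsto_intros S p)
  qed
  moreover have "f \<in> B \<rightarrow> B" using f by (auto simp: B_def)
  ultimately obtain p where p: "p \<in> B" "f p = p" using brouwer by metis
  have "0 \<le> fst p" "0 \<le> snd p" using p(1) by (auto simp: B_def)
  from f[OF this] have "0 < fst p" "0 < snd p" by (simp_all add: p(2))
  moreover have "fst p = rhs1 S (fst p) (snd p)" "snd p = rhs2 S (fst p) (snd p)"
    using p(2) by (simp_all add: f_def prod_eq_iff)
  ultimately show ?thesis by (rule that)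
qed

lemma deltas_sol:
  assumes Q: "nonneg_hermitian Q" "Q \<noteq> 0"
  shows "sol Q k kt \<longleftrightarrow> deltas \<sigma> K A C Ct Q = (k, kt)"
proof -
  have iff: "0 < fst p \<and> 0 < snd p \<and> delta_system \<sigma> K A C Ct Q (fst p) (snd p) \<longleftrightarrow> sol Q (fst p) (snd p)" for p
    using delta_system_iff[OF Q(1), of "fst p" "snd p"] by (auto simp: sol_def)
  have "msqrt Q \<noteq> 0" using msqrt_square[OF Q(1)] Q(2) by auto
  then obtain k0 kt0 where s: "sol Q k0 kt0"
    using fixed_point_exists[OF nonneg_msqrt[OF Q(1)]] unfolding sol_def by blast
  have "deltas \<sigma> K A C Ct Q = (k0, kt0)"
    unfolding deltas_def iff
  proof (rule the_equality)
    fix p assume "sol Q (fst p) (snd p)"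
    from sol_unique[OF Q(1) s this] show "p = (k0, kt0)" by (simp add: prod_eq_iff)
  qed (use s in simp)
  then show ?thesis using s sol_unique[OF Q(1) s, of k kt] by auto
qed

text \<open>Going from \<open>W = Q + e (R - Q)\<close> back to \<open>Q\<close> does not decrease \<open>V\<close>, so the tangent inequality
  at \<open>W\<close>, divided by \<open>e\<close>, gives the claim with \<open>W\<close> in place of \<open>Q\<close> inside the inverse; then
  \<open>e \<longlonglongrightarrow> 0\<close>.\<close>

lemma first_order_condition:
  assumes k: "0 < k" "0 \<le> kt" and max: "is_arg_max (V \<sigma> K A C Ct k kt) (\<lambda>R. R \<in> C1) Q" and R: "R \<in> C1"
  shows "Re (trace ((N ** (R - Q) ** adj N) ** matrix_inv (lifted k kt Q))) \<le> 0"
proof -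
  have Q: "Q \<in> C1" and opt: "\<And>W. W \<in> C1 \<Longrightarrow> V \<sigma> K A C Ct k kt W \<le> V \<sigma> K A C Ct k kt Q"
    using max by (auto simp: is_arg_max_linorder)
  define e where "e n = 1 / (real n + 1)" for n
  have e: "0 < e n" "e n \<le> 1" for n by (simp_all add: e_def)
  have e0: "e \<longlonglongrightarrow> 0" unfolding e_def using LIMSEQ_inverse_real_of_nat by (simp add: inverse_eq_divide add.commute)
  define W where "W n = Q + e n *\<^sub>R (R - Q)" for n
  have W: "W n \<in> C1" for n unfolding W_def by (intro C1_convex Q R) (use e less_imp_le in auto)
  have nn: "nonneg_hermitian Q" "nonneg_hermitian (W n)" for n using Q W by (simp_all add: C1_iff)
  have "W \<longlonglongrightarrow> Q + 0 *\<^sub>R (R - Q)" unfolding W_def by (intro tendsto_intros e0)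
  then have "(\<lambda>n. lifted k kt (W n)) \<longlonglongrightarrow> lifted k kt Q"
    unfolding lifted_def by (intro tendsto_intros) simp
  then have "(\<lambda>n. Re (trace ((N ** (R - Q) ** adj N) ** matrix_inv (lifted k kt (W n)))))
      \<longlonglongrightarrow> Re (trace ((N ** (R - Q) ** adj N) ** matrix_inv (lifted k kt Q)))"
    by (intro tendsto_intros pos_def_invertible pos_def_lifted k nn)
  moreover have "Re (trace ((N ** (R - Q) ** adj N) ** matrix_inv (lifted k kt (W n)))) \<le> 0" for n
  proof -
    have "N ** (Q - W n) ** adj N = (- e n) *\<^sub>R (N ** (R - Q) ** adj N)"
      by (simp add: W_def mat_ring)
    then have "Re (trace ((N ** (Q - W n) ** adj N) ** matrix_inv (lifted k kt (W n))))
      = - e n * Re (trace ((N ** (R - Q) ** adj N) ** matrix_inv (lifted k kt (W n))))"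
      by (simp only: scaleR_mult_left trace_scaleR) simp
    then have "V \<sigma> K A C Ct k kt Q \<le> V \<sigma> K A C Ct k kt (W n)
      - e n * Re (trace ((N ** (R - Q) ** adj N) ** matrix_inv (lifted k kt (W n))))"
      using V_tangent(1)[OF k k(2) nn(2) nn(1), of n] by simp
    with opt[OF W[of n]] have "e n * Re (trace ((N ** (R - Q) ** adj N) ** matrix_inv (lifted k kt (W n)))) \<le> 0"
      by linarith
    then show ?thesis using e[of n] by (simp add: mult_le_0_iff)
  qed
  ultimately show ?thesis by (intro LIMSEQ_le_const2) auto
qed

definition equilibrium :: "complex^'t^'t \<Rightarrow> bool"
  where "equilibrium Q \<longleftrightarrow> Q \<in> C1 \<and> (\<exists>k kt. sol Q k kt \<and> is_arg_max (V \<sigma> K A C Ct k kt) (\<lambda>R. R \<in> C1) Q)"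

text \<open>A \<open>\<kappa>\<close>-step at fixed product moves the parameters of \<open>R\<close> to the value of \<open>\<kappa>\<close> that belongs to
  \<open>Q\<close> and does not decrease \<open>V\<close>; then joint strict concavity at fixed \<open>\<kappa>\<close> applies, with both
  first-order terms nonpositive.\<close>

theorem equilibrium_maximizes_I_bar:
  assumes eq: "equilibrium Q" and R: "R \<in> C1" "R \<noteq> Q"
  shows "I_bar \<sigma> K A C Ct R < I_bar \<sigma> K A C Ct Q"
proof -
  obtain k kt where Q: "Q \<in> C1" and s: "sol Q k kt"
    and max: "is_arg_max (V \<sigma> K A C Ct k kt) (\<lambda>R. R \<in> C1) Q"
    using eq by (auto simp: equilibrium_def)
  have nn: "nonneg_hermitian Q" "nonneg_hermitian R" using Q R by (simp_all add: C1_iff)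
  have k: "0 < k" "0 \<le> kt" using s by (simp_all add: sol_def)
  obtain k' kt' where d: "deltas \<sigma> K A C Ct R = (k', kt')" by fastforce
  then have s': "sol R k' kt'" using deltas_sol[OF nn(2) C1_nonzero[OF R(1)]] by simp
  have q: "0 \<le> k' * kt' / k" using s' k by (simp add: sol_def)
  have "I_bar \<sigma> K A C Ct R = V \<sigma> K A C Ct k' kt' R" by (simp add: I_bar_def d)
  also have "\<dots> \<le> V \<sigma> K A C Ct k (k' * kt' / k) R" by (rule V_minimal_in_kappa(1)[OF nn(2) s' k(1)])
  also have "\<dots> < V \<sigma> K A C Ct k kt Q"
    using V_tangent[OF k q nn] sol_trace[OF nn(1) s] first_order_condition[OF k max R(1)] R(2)
    by fastforce
  also have "\<dots> = I_bar \<sigma> K A C Ct Q"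
    using s deltas_sol[OF nn(1) C1_nonzero[OF Q]] by (simp add: I_bar_def)
  finally show ?thesis .
qed

end

section \<open>Convergence of the algorithm\<close>

lemma nonneg_limit:
  fixes f :: "nat \<Rightarrow> complex^'n^'n"
  assumes f: "f \<longlonglongrightarrow> M" and nn: "\<And>n. nonneg_hermitian (f n)"
  shows "nonneg_hermitian M"
proof -
  have "(\<lambda>n. adj (f n)) \<longlonglongrightarrow> adj M" by (intro tendsto_intros f)
  then have "f \<longlonglongrightarrow> adj M" by (simp add: nonneg_hermitianD[OF nn])
  then have "adj M = M" using f LIMSEQ_unique by blast
  moreover have "0 \<le> Re (herm_form M x)" for x
  proof -
    have "(\<lambda>n. Re (herm_form (f n) x)) \<longlonglongrightarrow> Re (herm_form M x)"
      unfolding herm_form_def matrix_vector_mult_def vec_lambda_beta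
      by (intro tendsto_intros tendsto_component f)
    then show ?thesis by (rule LIMSEQ_le_const) (use nn in \<open>auto simp: nonneg_hermitian_def\<close>)
  qed
  ultimately show ?thesis by (simp add: nonneg_hermitian_def hermitian_def)
qed

context rician_channel
begin

lemma tendsto_V:
  assumes k: "(k \<longlongrightarrow> k0) G" "(kt \<longlongrightarrow> kt0) G" and Q: "(Q \<longlongrightarrow> Q0) G"
    and pos: "0 < k0" "0 < kt0" and nn: "\<And>x. nonneg_hermitian (Q x)" "nonneg_hermitian Q0"
  shows "((\<lambda>x. V \<sigma> K A C Ct (k x) (kt x) (Q x)) \<longlongrightarrow> V \<sigma> K A C Ct k0 kt0 Q0) G"
proof -
  have "((\<lambda>x. bdiag ((1 / k x) *\<^sub>R E0) (D (kt x))) \<longlongrightarrow> bdiag ((1 / k0) *\<^sub>R E0) (D kt0)) G"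
    unfolding bdiag_def D_def using pos by (intro tendsto_intros k) simp_all
  then have lift: "((\<lambda>x. lifted (k x) (kt x) (Q x)) \<longlongrightarrow> lifted k0 kt0 Q0) G"
    unfolding lifted_def by (intro tendsto_intros Q)
  have "((\<lambda>x. real CARD('t) * ln (k x) + logdet (a *\<^sub>R Ct) + logdet (lifted (k x) (kt x) (Q x))
      - a * \<tau> * k x * kt x) \<longlongrightarrow> real CARD('t) * ln k0 + logdet (a *\<^sub>R Ct) + logdet (lifted k0 kt0 Q0)
      - a * \<tau> * k0 * kt0) G"
    using pos by (intro tendsto_intros k lift pos_def_lifted nn) simp_all
  also have "real CARD('t) * ln k0 + logdet (a *\<^sub>R Ct) + logdet (lifted k0 kt0 Q0)
      - a * \<tau> * k0 * kt0 = V \<sigma> K A C Ct k0 kt0 Q0" using pos nn by (simp add: V_lifted)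
  finally show ?thesis
  proof (rule Lim_transform_eventually)
    have "\<forall>\<^sub>F x in G. 0 < k x" "\<forall>\<^sub>F x in G. 0 < kt x"
      using order_tendstoD(1)[OF k(1) pos(1)] order_tendstoD(1)[OF k(2) pos(2)] .
    then show "\<forall>\<^sub>F x in G. real CARD('t) * ln (k x) + logdet (a *\<^sub>R Ct) + logdet (lifted (k x) (kt x) (Q x))
      - a * \<tau> * k x * kt x = V \<sigma> K A C Ct (k x) (kt x) (Q x)"
      by eventually_elim (simp add: V_lifted nn)
  qed
qed

text \<open>A bound uniform over the constraint set, so that the parameters of the iterates have limit
  points.\<close>

lemma sol_bounded:
  obtains B where "\<And>Q k kt. Q \<in> C1 \<Longrightarrow> sol Q k kt \<Longrightarrow> \<bar>k\<bar> \<le> B \<and> \<bar>kt\<bar> \<le> B"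
proof -
  let ?g = "\<lambda>S. Re (trace (S ** Ct ** S)) / \<tau>"
  have "continuous_on (cball 0 (sqrt (real CARD('t)))) ?g"
    unfolding continuous_on_def using tau_pos by (intro ballI tendsto_intros) simp_all
  then have "bounded (?g ` cball 0 (sqrt (real CARD('t))))"
    by (intro compact_imp_bounded compact_continuous_image compact_cball)
  then obtain B where "\<forall>y \<in> ?g ` cball 0 (sqrt (real CARD('t))). norm y \<le> B"
    unfolding bounded_iff by blast
  then have B: "\<bar>?g S\<bar> \<le> B" if "S \<in> cball 0 (sqrt (real CARD('t)))" for S
    using that by fastforce
  have "\<bar>k\<bar> \<le> max B (Re (trace C) / \<tau>) \<and> \<bar>kt\<bar> \<le> max B (Re (trace C) / \<tau>)"
    if Q: "Q \<in> C1" and s: "sol Q k kt" for Q k kt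
  proof -
    have S: "nonneg_hermitian (msqrt Q)" using Q by (simp add: C1_iff nonneg_msqrt)
    have "norm (msqrt Q) = sqrt (real CARD('t))"
      using norm_msqrt[OF Q] by (metis norm_ge_zero real_sqrt_unique)
    then have "?g (msqrt Q) \<le> B" by (intro abs_le_D1[OF B]) simp
    moreover have "0 < k" "0 < kt" "k \<le> Re (trace C) / \<tau>" "kt \<le> ?g (msqrt Q)"
      using s rhs1_le[OF S, of k kt] rhs2_le[OF S, of k kt] by (simp_all add: sol_def)
    ultimately show ?thesis by linarith
  qed
  then show ?thesis by (rule that)
qed

end

locale rician_iteration = rician_channel \<sigma> K A C Ct
  for \<sigma> K :: real
    and A :: "complex^'t^'r" and C :: "complex^'r^'r" and Ct :: "complex^'t^'t" +
  fixes Q :: "nat \<Rightarrow> complex^'t^'t" and d dt :: "nat \<Rightarrow> real"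
  assumes Q0: "Q 0 = mat 1"
    and step_delta: "\<And>k. k \<ge> 1 \<Longrightarrow> (d k, dt k) = deltas \<sigma> K A C Ct (Q (k - 1))"
    and step_Q: "\<And>k. k \<ge> 1 \<Longrightarrow> is_arg_max (V \<sigma> K A C Ct (d k) (dt k)) (\<lambda>R. R \<in> C1) (Q k)"
    and d_diff: "(\<lambda>k. d k - d (k - 1)) \<longlonglongrightarrow> 0"
    and dt_diff: "(\<lambda>k. dt k - dt (k - 1)) \<longlonglongrightarrow> 0"
begin

lemma Q_C1: "Q n \<in> C1"
proof (cases n)
  case 0
  then show ?thesis by (simp add: Q0 C1_iff trace_I pos_def_imp_nonneg pos_def_one)
next
  case (Suc m)
  then show ?thesis using step_Q[of n] by (simp add: is_arg_max_def)
qed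

lemma Q_nonneg: "nonneg_hermitian (Q n)" using Q_C1 by (simp add: C1_iff)

lemma sol_step: "sol (Q n) (d (Suc n)) (dt (Suc n))"
  using step_delta[of "Suc n"] deltas_sol[OF Q_nonneg C1_nonzero[OF Q_C1]] by simp

text \<open>Extract a subsequence along which the square roots of the iterates and the parameters
  computed from them converge. The system passes to the limit, where positivity of its right-hand
  sides keeps the limits of the parameters positive; so does the inequality that expresses
  optimality of the iterates, since consecutive parameters have the same limits.\<close>

lemma subsequence_equilibrium:
  fixes r :: "nat \<Rightarrow> nat"
  assumes r: "strict_mono r"
  obtains s :: "nat \<Rightarrow> nat" and E where "strict_mono s" "(\<lambda>n. Q (r (s n))) \<longlonglongrightarrow> E" "equilibrium E"
proof -
  obtain B where B: "\<And>n. \<bar>d (Suc n)\<bar> \<le> B \<and> \<bar>dt (Suc n)\<bar> \<le> B"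
    using sol_bounded sol_step Q_C1 by metis
  define X where "X n = (msqrt (Q (r n)), d (Suc (r n)), dt (Suc (r n)))" for n
  have "norm (msqrt (Q n)) = sqrt (real CARD('t))" for n
    using norm_msqrt[OF Q_C1[of n]] by (metis norm_ge_zero real_sqrt_unique)
  then have "range X \<subseteq> cball 0 (sqrt (real CARD('t))) \<times> cball 0 B \<times> cball 0 B"
    using B by (auto simp: X_def)
  then have "bounded (range X)"
    by (rule bounded_subset[rotated]) (intro bounded_Times bounded_cball)
  then obtain L and s :: "nat \<Rightarrow> nat" where s: "strict_mono s" and L: "(X \<circ> s) \<longlonglongrightarrow> L"
    using bounded_imp_convergent_subsequence by blast
  define S k kt where "S = fst L" and "k = fst (snd L)" and "kt = snd (snd L)"
  have lim: "(\<lambda>n. msqrt (Q (r (s n)))) \<longlonglongrightarrow> S" "(\<lambda>n. d (Suc (r (s n)))) \<longlonglongrightarrow> k"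
    "(\<lambda>n. dt (Suc (r (s n)))) \<longlonglongrightarrow> kt"
    using tendsto_fst[OF L] tendsto_fst[OF tendsto_snd[OF L]] tendsto_snd[OF tendsto_snd[OF L]]
    by (simp_all add: X_def S_def k_def kt_def o_def)
  define E where "E = S ** S"
  have S: "nonneg_hermitian S" by (rule nonneg_limit[OF lim(1)]) (rule nonneg_msqrt[OF Q_nonneg])
  have E: "nonneg_hermitian E" "msqrt E = S"
    using nonneg_gram[of S] nonneg_hermitianD[OF S] msqrt_eqI[OF S] by (simp_all add: E_def)
  have "(\<lambda>n. msqrt (Q (r (s n))) ** msqrt (Q (r (s n)))) \<longlonglongrightarrow> E"
    unfolding E_def by (intro tendsto_intros lim(1))
  then have QE: "(\<lambda>n. Q (r (s n))) \<longlonglongrightarrow> E" by (simp add: msqrt_square[OF Q_nonneg])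
  have "(\<lambda>n. trace (Q (r (s n)))) \<longlonglongrightarrow> trace E" by (intro tendsto_intros QE)
  then have "trace E = of_nat CARD('t)" using Q_C1 by (simp add: C1_iff LIMSEQ_const_iff)
  then have EC: "E \<in> C1" using E by (simp add: C1_iff)
  have S0: "S \<noteq> 0" using C1_nonzero[OF EC] by (auto simp: E_def)
  have dpos: "0 < d (Suc n)" "0 < dt (Suc n)" for n using sol_step[of n] by (simp_all add: sol_def)
  have k0: "0 \<le> k" "0 \<le> kt"
    using LIMSEQ_le_const[OF lim(2), of 0] LIMSEQ_le_const[OF lim(3), of 0] dpos less_imp_le by blast+
  have "(\<lambda>n. rhs1 (msqrt (Q (r (s n)))) (d (Suc (r (s n)))) (dt (Suc (r (s n))))) \<longlonglongrightarrow> rhs1 S k kt"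
    "(\<lambda>n. rhs2 (msqrt (Q (r (s n)))) (d (Suc (r (s n)))) (dt (Suc (r (s n))))) \<longlonglongrightarrow> rhs2 S k kt"
    by (intro tendsto_rhs lim S k0)+
  then have "(\<lambda>n. d (Suc (r (s n)))) \<longlonglongrightarrow> rhs1 S k kt" "(\<lambda>n. dt (Suc (r (s n)))) \<longlonglongrightarrow> rhs2 S k kt"
    using sol_step by (simp_all add: sol_def)
  then have fp: "k = rhs1 S k kt" "kt = rhs2 S k kt" using lim LIMSEQ_unique by blast+
  have kpos: "0 < k" "0 < kt" using rhs1_pos[OF S k0] rhs2_pos[OF S S0 k0] fp by simp_all
  have sol: "sol E k kt" using kpos fp by (simp add: sol_def E)
  \<comment> \<open>The iterate \<open>Q m\<close> was chosen with the parameters of step \<open>m\<close>, while its own parameters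
    appear at step \<open>m + 1\<close>; both have the same limit.\<close>
  have rs: "filterlim (\<lambda>n. Suc (r (s n))) at_top sequentially"
    using filterlim_subseq[OF strict_mono_compose[OF r s]] by (simp add: filterlim_sequentially_Suc filterlim_compose[OF filterlim_Suc] o_def)
  have d': "(\<lambda>n. d (r (s n))) \<longlonglongrightarrow> k" "(\<lambda>n. dt (r (s n))) \<longlonglongrightarrow> kt"
    using tendsto_diff[OF lim(2) filterlim_compose[OF d_diff rs]]
      tendsto_diff[OF lim(3) filterlim_compose[OF dt_diff rs]] by simp_all
  have "V \<sigma> K A C Ct k kt R \<le> V \<sigma> K A C Ct k kt E" if R: "R \<in> C1" for R
  proof (rule LIMSEQ_le)
    show "(\<lambda>n. V \<sigma> K A C Ct (d (r (s n))) (dt (r (s n))) R) \<longlonglongrightarrow> V \<sigma> K A C Ct k kt R"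
      by (rule tendsto_V) (use d' kpos R in \<open>simp_all add: C1_iff\<close>)
    show "(\<lambda>n. V \<sigma> K A C Ct (d (r (s n))) (dt (r (s n))) (Q (r (s n)))) \<longlonglongrightarrow> V \<sigma> K A C Ct k kt E"
      by (rule tendsto_V) (use d' kpos QE Q_nonneg E in simp_all)
    have "V \<sigma> K A C Ct (d (r (s n))) (dt (r (s n))) R \<le> V \<sigma> K A C Ct (d (r (s n))) (dt (r (s n))) (Q (r (s n)))"
      if "1 \<le> n" for n
    proof -
      have "n \<le> r (s n)" using seq_suble[OF strict_mono_compose[OF r s]] by (simp add: o_def)
      then show ?thesis using step_Q[of "r (s n)"] that R by (simp add: is_arg_max_linorder)
    qed
    then show "\<exists>m. \<forall>n\<ge>m. V \<sigma> K A C Ct (d (r (s n))) (dt (r (s n))) R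
      \<le> V \<sigma> K A C Ct (d (r (s n))) (dt (r (s n))) (Q (r (s n)))" by blast
  qed
  then have "equilibrium E" using EC sol by (auto simp: equilibrium_def is_arg_max_linorder)
  with s QE show ?thesis by (rule that)
qed

text \<open>Two distinct equilibria would each have a larger value of \<open>I_bar\<close> than the other, so all limit
  points coincide.\<close>

theorem converges_to_maximizer:
  obtains E where "is_arg_max (I_bar \<sigma> K A C Ct) (\<lambda>R. R \<in> C1) E"
    "\<And>R. is_arg_max (I_bar \<sigma> K A C Ct) (\<lambda>R. R \<in> C1) R \<Longrightarrow> R = E" "Q \<longlonglongrightarrow> E"
proof -
  have "strict_mono (\<lambda>n :: nat. n)" by (simp add: strict_mono_def)
  from subsequence_equilibrium[OF this] obtain E where E: "equilibrium E" by blast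
  have EC: "E \<in> C1" using E by (simp add: equilibrium_def)
  note less = equilibrium_maximizes_I_bar[OF E]
  have "I_bar \<sigma> K A C Ct R \<le> I_bar \<sigma> K A C Ct E" if "R \<in> C1" for R
    using less[OF that] by (cases "R = E") simp_all
  then have "is_arg_max (I_bar \<sigma> K A C Ct) (\<lambda>R. R \<in> C1) E"
    using EC by (simp add: is_arg_max_linorder)
  moreover have "R = E" if "is_arg_max (I_bar \<sigma> K A C Ct) (\<lambda>R. R \<in> C1) R" for R
  proof (rule ccontr)
    assume "R \<noteq> E"
    moreover have "R \<in> C1" "I_bar \<sigma> K A C Ct E \<le> I_bar \<sigma> K A C Ct R"
      using that EC by (simp_all add: is_arg_max_linorder)
    ultimately show False using less[of R] by simp
  qed
  moreover have "Q \<longlonglongrightarrow> E"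
  proof (rule ccontr)
    assume "\<not> Q \<longlonglongrightarrow> E"
    then obtain e where e: "0 < e" "\<not> (\<forall>\<^sub>F n in sequentially. dist (Q n) E < e)"
      unfolding tendsto_iff by blast
    then have "infinite {n. e \<le> dist (Q n) E}"
      by (simp add: not_eventually frequently_sequentially infinite_nat_iff_unbounded_le not_less)
    then obtain r :: "nat \<Rightarrow> nat" where r: "strict_mono r" "\<And>n. r n \<in> {n. e \<le> dist (Q n) E}"
      using infinite_enumerate by blast
    obtain s E' where E': "(\<lambda>n. Q (r (s n))) \<longlonglongrightarrow> E'" "equilibrium E'"
      by (rule subsequence_equilibrium[OF r(1)])
    have "E' = E"
    proof (rule ccontr)
      assume ne: "E' \<noteq> E"
      have "E' \<in> C1" using E'(2) by (simp add: equilibrium_def)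
      from less[OF this ne] equilibrium_maximizes_I_bar[OF E'(2) EC ne[symmetric]] show False by simp
    qed
    then have "(\<lambda>n. dist (Q (r (s n))) E) \<longlonglongrightarrow> 0" using E'(1) by (simp add: tendsto_dist_iff[of _ E])
    then have "e \<le> 0" by (rule LIMSEQ_le_const) (use r(2) in auto)
    then show False using e(1) by simp
  qed
  ultimately show ?thesis by (rule that)
qed

end

theorem proposition6:
  fixes \<sigma> K :: real
    and A :: "complex^'t^'r" and C :: "complex^'r^'r" and Ct :: "complex^'t^'t"
    and Q :: "nat \<Rightarrow> complex^'t^'t" and d dt :: "nat \<Rightarrow> real"
  assumes "\<sigma>\<^sup>2 > 0" and "K \<ge> 0"
    and "1 / of_nat CARD('r) * trace (A ** adj A) = 1"
    and "pos_def_hermitian C" and "1 / of_nat CARD('r) * trace C = 1"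
    and "pos_def_hermitian Ct" and "1 / of_nat CARD('t) * trace Ct = 1"
    and "Q 0 = mat 1"
    and "\<And>k. k \<ge> 1 \<Longrightarrow> (d k, dt k) = deltas \<sigma> K A C Ct (Q (k - 1))"
    and "\<And>k. k \<ge> 1 \<Longrightarrow> is_arg_max (V \<sigma> K A C Ct (d k) (dt k)) (\<lambda>R. R \<in> C1) (Q k)"
    and "(\<lambda>k. d k - d (k - 1)) \<longlonglongrightarrow> 0"
    and "(\<lambda>k. dt k - dt (k - 1)) \<longlonglongrightarrow> 0"
  shows "\<exists>Qs. is_arg_max (I_bar \<sigma> K A C Ct) (\<lambda>R. R \<in> C1) Qs
    \<and> (\<forall>R. is_arg_max (I_bar \<sigma> K A C Ct) (\<lambda>R. R \<in> C1) R \<longrightarrow> R = Qs)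
    \<and> Q \<longlonglongrightarrow> Qs"
proof -
  interpret rician_iteration \<sigma> K A C Ct Q d dt
    by unfold_locales (use assms in simp_all)
  show ?thesis by (rule converges_to_maximizer) blast
qed

end
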